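(* Let $G$ be an extremal $4$-cactus with $n\ge 1$ vertices. Then: (1) If $n\equiv 0\pmod 3$, then $G$ is obtained by coalescing $\frac{n-3}{3}$ copies of $K_4$ and one copy of $K_3$, or obtained by coalescing $\frac{n-6}{3}$ copies of $K_4$ and one copy of $\theta(1,2,2,2,2)$. (2) If $n\equiv 1\pmod 3$ and $n\ne 1$, then $G$ is obtained by coalescing $\frac{n-1}{3}$ copies of $K_4$; if $n=1$, then $G\cong K_1$. (3) If $n\equiv 2\pmod 3$, then $G$ is either obtained by coalescing $\frac{n-2}{3}$ copies of $K_4$ and one copy of $K_2$, or obtained by coalescing $\frac{n-5}{3}$ copies of $K_4$ and exactly one copy of one of the graphs $\theta(1,2,2,2)$, $\tilde{\theta}_1$, $\tilde{\theta}_2$.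
   Context: All graphs are finite and simple. For an integer $k\ge 1$, a $k$-cactus is a connected graph in which every edge is contained in at most $k$ cycles. A $k$-cactus with $n$ vertices is extremal if it has the largest number of edges among all $k$-cacti with $n$ vertices. For $t\ge 3$, $\theta(l_1,\dots,l_t)$ denotes the union of $t$ internally vertex-disjoint paths of lengths $l_1,\dots,l_t$ with the same two end-vertices. The graphs $\tilde{\theta}_1$ and $\tilde{\theta}_2$ are the two graphs on 5 vertices with 7 edges other than $\theta(1,2,2,2)$ that are $2$-connected: namely the complement of the disjoint union of a path with 3 edges and an isolated vertex, and the complement of the disjoint union of a path with 2 edges and a single edge. The coalescence of two vertex-disjoint graphs $G_1,G_2$ at vertices $v_1\in V(G_1)$, $v_2\in V(G_2)$ is the graph obtained from $G_1\cup G_2$ by identifying $v_1$ and $v_2$ into one vertex; a coalescence of several pairwise disjoint graphs is defined iteratively. "Obtained by coalescing" the listed graphs means $G$ is some such coalescence of them. *)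

theory Defs
  imports "HOL-Library.Multiset"
begin

type_synonym 'a ugraph = "'a set \<times> 'a set set"

abbreviation verts :: "'a ugraph \<Rightarrow> 'a set" where
  "verts G \<equiv> fst G"

abbreviation edges :: "'a ugraph \<Rightarrow> 'a set set" where
  "edges G \<equiv> snd G"

definition all_edges :: "'a set \<Rightarrow> 'a set set" where
  "all_edges V = {{u, v} | u v. u \<in> V \<and> v \<in> V \<and> u \<noteq> v}"

definition finite_simple_graph :: "'a ugraph \<Rightarrow> bool" where
  "finite_simple_graph G \<longleftrightarrow> finite (verts G) \<and> edges G \<subseteq> all_edges (verts G)"

definition connected_graph :: "'a ugraph \<Rightarrow> bool" where
  "connected_graph G \<longleftrightarrow>
     (\<forall>u \<in> verts G. \<forall>v \<in> verts G. (u, v) \<in> {(x, y). {x, y} \<in> edges G}\<^sup>*)"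

definition path_edges :: "'a list \<Rightarrow> 'a set set" where
  "path_edges xs = {{xs ! i, xs ! Suc i} | i. Suc i < length xs}"

text \<open>
  A cycle of a graph is represented by its edge set, so that the different starting points and
  the two orientations of a cycle are not counted separately.
\<close>
definition is_cycle :: "'a ugraph \<Rightarrow> 'a set set \<Rightarrow> bool" where
  "is_cycle G C \<longleftrightarrow> C \<subseteq> edges G \<and>
     (\<exists>xs. distinct xs \<and> length xs \<ge> 3 \<and> C = insert {last xs, hd xs} (path_edges xs))"

definition k_cactus :: "nat \<Rightarrow> 'a ugraph \<Rightarrow> bool" where
  "k_cactus k G \<longleftrightarrow> finite_simple_graph G \<and> connected_graph G \<and>
     (\<forall>e \<in> edges G. card {C. is_cycle G C \<and> e \<in> C} \<le> k)"

text \<open>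
  The competitors \<open>H\<close> live on the same vertex type as \<open>G\<close>. This is no restriction: every graph
  with \<open>n\<close> vertices has an isomorphic copy on the \<open>n\<close> vertices of \<open>G\<close>.
\<close>
definition extremal_k_cactus :: "nat \<Rightarrow> nat \<Rightarrow> 'a ugraph \<Rightarrow> bool" where
  "extremal_k_cactus k n G \<longleftrightarrow> k_cactus k G \<and> card (verts G) = n \<and>
     (\<forall>H :: 'a ugraph. k_cactus k H \<and> card (verts H) = n \<longrightarrow> card (edges H) \<le> card (edges G))"

definition graph_iso :: "'a ugraph \<Rightarrow> 'b ugraph \<Rightarrow> bool" where
  "graph_iso G H \<longleftrightarrow>
     (\<exists>f. bij_betw f (verts G) (verts H) \<and> edges H = (\<lambda>e. f ` e) ` edges G)"

definition complete_graph :: "nat \<Rightarrow> nat ugraph" where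
  "complete_graph m = ({0..<m}, all_edges {0..<m})"

definition complement_graph :: "'a ugraph \<Rightarrow> 'a ugraph" where
  "complement_graph G = (verts G, all_edges (verts G) - edges G)"

text \<open>
  The common end-vertices of the paths are \<open>0\<close> and \<open>1\<close>; the interior vertices are numbered
  consecutively from \<open>2\<close>, path after path. The lengths should be positive, and at most one of
  them equal to \<open>1\<close> (parallel edges would be merged).
\<close>
definition theta_path :: "nat list \<Rightarrow> nat \<Rightarrow> nat list" where
  "theta_path ls i =
     (let s = 2 + (\<Sum>j<i. ls ! j - 1) in [0] @ [s..<s + (ls ! i - 1)] @ [1])"

definition theta :: "nat list \<Rightarrow> nat ugraph" where
  "theta ls = ((\<Union>i<length ls. set (theta_path ls i)),
               (\<Union>i<length ls. path_edges (theta_path ls i)))"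

definition theta_tilde1 :: "nat ugraph" where
  "theta_tilde1 = complement_graph ({0..<5}, {{0, 1}, {1, 2}, {2, 3}})"

definition theta_tilde2 :: "nat ugraph" where
  "theta_tilde2 = complement_graph ({0..<5}, {{0, 1}, {1, 2}, {3, 4}})"

text \<open>
  The identified vertex keeps the name \<open>v1\<close>. The operation is meant for graphs with disjoint
  vertex sets and for \<open>v1 \<in> verts G1\<close>, \<open>v2 \<in> verts G2\<close>.
\<close>
definition coalesce :: "'a ugraph \<Rightarrow> 'a \<Rightarrow> 'a ugraph \<Rightarrow> 'a \<Rightarrow> 'a ugraph" where
  "coalesce G1 v1 G2 v2 =
     (let r = (\<lambda>x. if x = v2 then v1 else x)
      in (verts G1 \<union> r ` verts G2, edges G1 \<union> (\<lambda>e. r ` e) ` edges G2))"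

text \<open>
  \<open>is_coalescence M G\<close>: \<open>G\<close> arises by iterated coalescence from disjoint copies of the graphs in
  the multiset \<open>M\<close>. The vertex type is \<open>nat\<close> because an infinite supply of vertices is
  needed to have disjoint copies.
\<close>
inductive is_coalescence :: "nat ugraph multiset \<Rightarrow> nat ugraph \<Rightarrow> bool" where
  single: "graph_iso H G \<Longrightarrow> is_coalescence {#H#} G"
| join: "is_coalescence M1 G1 \<Longrightarrow> is_coalescence M2 G2 \<Longrightarrow> verts G1 \<inter> verts G2 = {} \<Longrightarrow>
    v1 \<in> verts G1 \<Longrightarrow> v2 \<in> verts G2 \<Longrightarrow> is_coalescence (M1 + M2) (coalesce G1 v1 G2 v2)"

definition obtained_by_coalescing :: "nat ugraph multiset \<Rightarrow> 'a ugraph \<Rightarrow> bool" where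
  "obtained_by_coalescing M G \<longleftrightarrow> (\<exists>H. is_coalescence M H \<and> graph_iso G H)"

end

theory Submission
  imports Defs
begin

text \<open>
  Call \<open>2(n - 1) - |E|\<close> the defect of a connected graph with \<open>n\<close> vertices. Cutting a graph at a cut
  vertex adds up defects, so it suffices to understand the blocks. Grow a block from one of its edges
  by successively adding ears: each ear raises \<open>|E| - n\<close> by one and closes a new cycle through the
  edge, so \<open>|E| \<le> n + 3\<close> for a block of a 4-cactus. Hence blocks have defect at least 0, and defect at
  most 1 forces \<open>n \<le> 6\<close>. Inspecting these few graphs shows that \<open>K\<^sub>4\<close> is the only block of defect 0
  and that the blocks of defect 1 are the exceptional ones of the theorem, apart from 4-vertex blocks,
  which leave \<open>n\<close> congruent to 1 modulo 3. On the other hand, gluing copies of \<open>K\<^sub>4\<close> to \<open>K\<^sub>1\<close>, \<open>K\<^sub>2\<close>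
  or \<open>K\<^sub>3\<close> gives 4-cacti of defect 0 if \<open>n\<close> is congruent to 1 modulo 3 and of defect 1 otherwise.
\<close>

section \<open>Splitting at a cut vertex and coalescence\<close>

text \<open>The factor 2 in the defect comes from K_4: gluing on one more copy adds three vertices
  and six edges. A single edge has |E| - n = -1 and lies on no cycle of its own, so the ears give at
  least |E| - n + 1 cycles through it; a block of a 4-cactus thus has defect at least n - 5.

  The obstacle is that an ear closes a cycle through the starting edge only if its two ends can be
  joined to the two ends of that edge by disjoint paths. This property is carried along as an
  invariant for all pairs of vertices: it is trivial for the edge itself and passes from a subgraph
  to the subgraph with one more ear.

  The count alone admits blocks that are not 4-cacti: eight edges on five vertices, and nine edges
  on six vertices other than the theta graph. They are excluded by five explicit cycles through one
  edge. Vertices become list indices there, so that evaluation on numbers checks each certificate,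
  and only the classification of the graphs is left to reasoning.\<close>

definition map_graph :: "('a \<Rightarrow> 'b) \<Rightarrow> 'a ugraph \<Rightarrow> 'b ugraph" where
  "map_graph f G = (f ` verts G, (\<lambda>e. f ` e) ` edges G)"

definition induced :: "'a ugraph \<Rightarrow> 'a set \<Rightarrow> 'a ugraph" where
  "induced G A = (A, {e \<in> edges G. e \<subseteq> A})"

text \<open>Two sides are used rather than the components left after deleting \<open>v\<close>: a
  side may collect several components, and exhibiting a split needs no connectivity argument. The
  trivial side {v} is allowed here; \<open>nonseparable\<close> asks for two vertices on each
  side.\<close>

definition split_at :: "'a ugraph \<Rightarrow> 'a \<Rightarrow> 'a set \<Rightarrow> 'a set \<Rightarrow> bool" where
  "split_at G v A B \<longleftrightarrow> A \<union> B = verts G \<and> A \<inter> B = {v} \<and> (\<forall>e \<in> edges G. e \<subseteq> A \<or> e \<subseteq> B)"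

definition nonseparable :: "'a ugraph \<Rightarrow> bool" where
  "nonseparable G \<longleftrightarrow> \<not> (\<exists>v A B. split_at G v A B \<and> 2 \<le> card A \<and> 2 \<le> card B)"

lemma finite_all_edges: "finite V \<Longrightarrow> finite (all_edges V)"
  by (rule finite_subset[of _ "Pow V"]) (auto simp: all_edges_def)

lemma finite_edges: "finite_simple_graph G \<Longrightarrow> finite (edges G)"
  unfolding finite_simple_graph_def by (meson finite_all_edges finite_subset)

lemma split_at_sym: "split_at G v A B \<Longrightarrow> split_at G v B A"
  unfolding split_at_def by auto

section \<open>Isomorphism, renaming and coalescence\<close>

lemma graph_isoI:
  "bij_betw f (verts G) (verts H) \<Longrightarrow> edges H = (\<lambda>e. f ` e) ` edges G \<Longrightarrow> graph_iso G H"
  unfolding graph_iso_def by (rule exI[of _ f]) simp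

lemma graph_isoE:
  assumes "graph_iso G H"
  obtains f where "bij_betw f (verts G) (verts H)" "edges H = (\<lambda>e. f ` e) ` edges G"
  using assms unfolding graph_iso_def by (elim exE conjE)

lemma graph_iso_refl: "graph_iso G G"
  unfolding graph_iso_def by (rule exI[of _ id]) auto

lemma graph_iso_trans:
  assumes "graph_iso G H" "graph_iso H K"
  shows "graph_iso G K"
proof -
  obtain f where f: "bij_betw f (verts G) (verts H)" "edges H = (\<lambda>e. f ` e) ` edges G"
    using assms(1) by (rule graph_isoE)
  obtain g where g: "bij_betw g (verts H) (verts K)" "edges K = (\<lambda>e. g ` e) ` edges H"
    using assms(2) by (rule graph_isoE)
  have "bij_betw (g \<circ> f) (verts G) (verts K)"
    using f(1) g(1) by (rule bij_betw_trans)
  moreover have "edges K = (\<lambda>e. (g \<circ> f) ` e) ` edges G"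
    unfolding g(2) f(2) by (simp only: image_image comp_def)
  ultimately show ?thesis by (rule graph_isoI)
qed

text \<open>Simplicity keeps every edge inside the vertex set, where \<open>inv_into\<close> undoes
  \<open>f\<close>; an edge leaving the vertex set might not be recovered from its image.\<close>

lemma graph_iso_sym:
  assumes iso: "graph_iso G H" and simple: "finite_simple_graph G"
  shows "graph_iso H G"
proof -
  obtain f where f: "bij_betw f (verts G) (verts H)" "edges H = (\<lambda>e. f ` e) ` edges G"
    using iso by (rule graph_isoE)
  let ?g = "inv_into (verts G) f"
  have "?g ` f ` e = e" if "e \<in> edges G" for e
  proof -
    have "e \<subseteq> verts G"
      using that simple unfolding finite_simple_graph_def all_edges_def by fast
    thus ?thesis using f(1) by (simp add: bij_betw_def inv_into_image_cancel)
  qed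
  hence "edges G = (\<lambda>e. ?g ` e) ` edges H"
    using f(2) by (force simp: image_image)
  with bij_betw_inv_into[OF f(1)] show ?thesis by (rule graph_isoI)
qed

lemma graph_iso_map_graph:
  "inj_on f (verts G) \<Longrightarrow> graph_iso G (map_graph f G)"
  by (rule graph_isoI[of f]) (simp_all add: map_graph_def bij_betw_def)

text \<open>Allows two coalescences to be moved to disjoint sets of numbers. Injectivity on the
  whole type keeps the vertex sets disjoint at every inner gluing.\<close>

lemma is_coalescence_map_graph:
  assumes "is_coalescence M G" "inj f"
  shows "is_coalescence M (map_graph f G)"
  using assms(1)
proof induction
  case (single H G)
  thus ?case
    using assms(2) by (meson graph_iso_map_graph graph_iso_trans inj_on_subset is_coalescence.single top_greatest)
next
  case (join M1 G1 M2 G2 v1 v2)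
  let ?r = "\<lambda>x. if x = v2 then v1 else x" and ?s = "\<lambda>x. if x = f v2 then f v1 else x"
  have rs: "f (?r x) = ?s (f x)" for x
    using assms(2) by (auto dest: injD)
  have "map_graph f (coalesce G1 v1 G2 v2) =
      coalesce (map_graph f G1) (f v1) (map_graph f G2) (f v2)"
    unfolding map_graph_def coalesce_def Let_def
    by (simp add: image_Un image_image rs del: if_image_distrib)
  moreover have "is_coalescence (M1 + M2)
      (coalesce (map_graph f G1) (f v1) (map_graph f G2) (f v2))"
    using join assms(2)
    by (intro is_coalescence.join) (auto simp: map_graph_def dest: injD)
  ultimately show ?case by simp
qed

lemma obtained_by_coalescing_single:
  assumes "finite_simple_graph H" "graph_iso H G"
  shows "obtained_by_coalescing {#H#} G"
  unfolding obtained_by_coalescing_def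
  using is_coalescence.single[OF graph_iso_refl] graph_iso_sym[OF assms(2,1)] by blast

text \<open>The isomorphisms of the two parts are made disjoint and then merged into one map; they
  conflict only at \<open>v\<close>, and there the coalescence identifies their values.\<close>

lemma obtained_by_coalescing_split:
  assumes split: "split_at G v A B"
    and 1: "obtained_by_coalescing M1 (induced G A)" and 2: "obtained_by_coalescing M2 (induced G B)"
  shows "obtained_by_coalescing (M1 + M2) G"
proof -
  obtain H1 f1 where H1: "is_coalescence M1 H1" and f1: "bij_betw f1 A (verts H1)"
      "edges H1 = (\<lambda>e. f1 ` e) ` {e \<in> edges G. e \<subseteq> A}"
    using 1 unfolding obtained_by_coalescing_def graph_iso_def induced_def by auto
  obtain H2 f2 where H2: "is_coalescence M2 H2" and f2: "bij_betw f2 B (verts H2)"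
      "edges H2 = (\<lambda>e. f2 ` e) ` {e \<in> edges G. e \<subseteq> B}"
    using 2 unfolding obtained_by_coalescing_def graph_iso_def induced_def by auto
  \<comment> \<open>The first model is moved to the even numbers and the second to the odd
    ones.\<close>
  define d1 d2 :: "nat \<Rightarrow> nat" where "d1 x = 2 * x" and "d2 x = 2 * x + 1" for x
  have d: "inj d1" "inj d2" "d1 x \<noteq> d2 y" for x y
    by (auto simp: d1_def d2_def inj_on_def) presburger
  define g1 g2 where "g1 = d1 \<circ> f1" and "g2 = d2 \<circ> f2"
  have sep: "g1 x \<noteq> g2 y" for x y using d(3) by (simp add: g1_def g2_def)
  have inj: "inj_on g1 A" "inj_on g2 B"
    using f1(1) f2(1) d(1,2) unfolding g1_def g2_def bij_betw_def
    by (meson comp_inj_on inj_on_subset top_greatest)+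
  have vA: "v \<in> A" and vB: "v \<in> B" and V: "verts G = A \<union> B" and AB: "A \<inter> B = {v}"
    using split unfolding split_at_def by auto
  let ?H1 = "map_graph d1 H1" and ?H2 = "map_graph d2 H2"
  have verts: "verts ?H1 = g1 ` A" "verts ?H2 = g2 ` B"
    using f1(1) f2(1) unfolding map_graph_def g1_def g2_def bij_betw_def
    by (simp_all only: image_comp[symmetric] fst_conv)
  have edges: "edges ?H1 = (\<lambda>e. g1 ` e) ` {e \<in> edges G. e \<subseteq> A}"
      "edges ?H2 = (\<lambda>e. g2 ` e) ` {e \<in> edges G. e \<subseteq> B}"
    unfolding map_graph_def g1_def g2_def snd_conv f1(2) f2(2) image_comp[symmetric] by (simp_all only: image_image)
  let ?K = "coalesce ?H1 (g1 v) ?H2 (g2 v)"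
  let ?r = "\<lambda>x. if x = g2 v then g1 v else x"
  \<comment> \<open>At \<open>v\<close>, which lies on both sides, \<open>g1\<close> wins: the
    coalescence keeps the name \<open>g1 v\<close>.\<close>
  define h where "h x = (if x \<in> A then g1 x else g2 x)" for x
  have hA: "h x = g1 x" if "x \<in> A" for x using that by (simp add: h_def)
  have hB: "h x = ?r (g2 x)" if "x \<in> B" for x
  proof (cases "x = v")
    case False
    hence "x \<notin> A" using AB that by auto
    thus ?thesis using False that vB inj(2) by (auto simp: h_def dest: inj_onD)
  qed (use vA in \<open>simp add: h_def\<close>)
  have co: "is_coalescence (M1 + M2) ?K"
    using sep verts vA vB
    by (intro is_coalescence.join is_coalescence_map_graph H1 H2 d) auto
  have Kv: "verts ?K = g1 ` A \<union> ?r ` g2 ` B"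
    using verts by (simp add: coalesce_def Let_def)
  have "h ` A = g1 ` A" using hA by auto
  moreover have "h ` B = ?r ` g2 ` B" using hB by (simp only: image_image cong: image_cong)
  ultimately have Kv': "verts ?K = h ` verts G" unfolding Kv V image_Un by simp
  have "inj_on h (verts G)"
    unfolding V h_def using inj sep sep[symmetric]
    by (auto simp: inj_on_def split: if_splits)
  hence "bij_betw h (verts G) (verts ?K)" using Kv' by (simp add: bij_betw_def)
  moreover have "edges ?K = (\<lambda>e. h ` e) ` edges G"
  proof -
    have E: "edges G = {e \<in> edges G. e \<subseteq> A} \<union> {e \<in> edges G. e \<subseteq> B}"
      using split unfolding split_at_def by auto
    have "h ` e = g1 ` e" if "e \<subseteq> A" for e using that hA by (auto intro!: image_cong)
    hence a: "(\<lambda>e. h ` e) ` {e \<in> edges G. e \<subseteq> A} = edges ?H1"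
      unfolding edges by (auto intro!: image_cong)
    have "h ` e = ?r ` g2 ` e" if "e \<subseteq> B" for e
      unfolding image_image using that hB by (intro image_cong) auto
    hence b: "(\<lambda>e. h ` e) ` {e \<in> edges G. e \<subseteq> B} = (\<lambda>e. ?r ` e) ` edges ?H2"
      unfolding edges image_image[of "\<lambda>e. ?r ` e"] by (intro image_cong) auto
    have "(\<lambda>e. h ` e) ` edges G = edges ?H1 \<union> (\<lambda>e. ?r ` e) ` edges ?H2"
      by (subst E) (simp only: image_Un a b)
    thus ?thesis by (simp add: coalesce_def Let_def)
  qed
  ultimately have "graph_iso G ?K" by (rule graph_isoI)
  thus ?thesis using co unfolding obtained_by_coalescing_def by blast
qed

section \<open>The parts of a split\<close>

lemma connected_induced_split:
  assumes con: "connected_graph G" and split: "split_at G v A B"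
  shows "connected_graph (induced G A)"
proof -
  let ?S = "{(x, y). {x, y} \<in> edges G}" and ?T = "{(x, y). {x, y} \<in> edges (induced G A)}"
  \<comment> \<open>Retracting \<open>B\<close> onto the cut vertex maps walks of the whole graph to walks of the part.\<close>
  let ?r = "\<lambda>x. if x \<in> A then x else v"
  have v: "v \<in> A" "A \<inter> B = {v}" "A \<subseteq> verts G" using split unfolding split_at_def by auto
  have edge: "(?r x, ?r y) \<in> ?T\<^sup>*" if "{x, y} \<in> edges G" for x y
  proof -
    have "\<forall>e \<in> edges G. e \<subseteq> A \<or> e \<subseteq> B" using split unfolding split_at_def by simp
    from bspec[OF this that] consider "{x, y} \<subseteq> A" | "{x, y} \<subseteq> B" by linarith
    thus ?thesis
    proof cases
      case 1
      thus ?thesis using that by (auto simp: induced_def)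
    next
      case 2
      hence "?r x = v" "?r y = v" using v by auto
      thus ?thesis by simp
    qed
  qed
  have "(?r x, ?r y) \<in> ?T\<^sup>*" if "(x, y) \<in> ?S\<^sup>*" for x y
    using that
  proof induction
    case (step y z)
    have "{y, z} \<in> edges G" using step.hyps(2) by simp
    from rtrancl_trans[OF step.IH edge[OF this]] show ?case .
  qed simp
  moreover have "(x, y) \<in> ?S\<^sup>*" if "x \<in> A" "y \<in> A" for x y
    using that con v unfolding connected_graph_def by blast
  ultimately have "(?r x, ?r y) \<in> ?T\<^sup>*" if "x \<in> A" "y \<in> A" for x y using that by blast
  hence "(x, y) \<in> ?T\<^sup>*" if "x \<in> A" "y \<in> A" for x y using that by fastforce
  thus ?thesis unfolding connected_graph_def by (simp add: induced_def)
qed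

lemma is_cycle_mono: "is_cycle G C \<Longrightarrow> edges G \<subseteq> edges H \<Longrightarrow> is_cycle H C"
  unfolding is_cycle_def by auto

lemma finite_cycles: "finite_simple_graph G \<Longrightarrow> finite {C. is_cycle G C \<and> e \<in> C}"
  by (rule finite_subset[of _ "Pow (edges G)"]) (auto simp: is_cycle_def finite_edges)

lemma k_cactus_induced_split:
  assumes "k_cactus k G" "split_at G v A B"
  shows "k_cactus k (induced G A)"
proof -
  have s: "finite_simple_graph G" and c: "connected_graph G"
    using assms(1) unfolding k_cactus_def by auto
  have "A \<subseteq> verts G" using assms(2) unfolding split_at_def by auto
  moreover have "e \<in> all_edges A" if "e \<in> all_edges (verts G)" "e \<subseteq> A" for e
    using that unfolding all_edges_def by auto
  ultimately have "finite_simple_graph (induced G A)"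
    using s unfolding finite_simple_graph_def induced_def by (auto intro: finite_subset)
  moreover have "card {C. is_cycle (induced G A) C \<and> e \<in> C} \<le> k" if "e \<in> edges (induced G A)" for e
  proof -
    have "e \<in> edges G" "edges (induced G A) \<subseteq> edges G" using that by (auto simp: induced_def)
    hence "{C. is_cycle (induced G A) C \<and> e \<in> C} \<subseteq> {C. is_cycle G C \<and> e \<in> C}"
      using is_cycle_mono by blast
    thus ?thesis using finite_cycles[OF s] assms(1) \<open>e \<in> edges G\<close> unfolding k_cactus_def
      by (meson card_mono order_trans)
  qed
  ultimately show ?thesis
    using connected_induced_split[OF c assms(2)] unfolding k_cactus_def by blast
qed

text \<open>No edge fits into {v}, so no edge is counted twice, whereas \<open>v\<close> is.
  Together the two equations say that defects add up.\<close>

lemma card_edges_split: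
  assumes s: "finite_simple_graph G" and "split_at G v A B"
  shows "card (edges G) = card (edges (induced G A)) + card (edges (induced G B))"
    and "card (verts G) + 1 = card A + card B"
proof -
  have AB: "A \<inter> B = {v}" "A \<union> B = verts G" "\<forall>e \<in> edges G. e \<subseteq> A \<or> e \<subseteq> B"
    using assms(2) unfolding split_at_def by auto
  have "\<not> e \<subseteq> {v}" if "e \<in> edges G" for e
    using s that unfolding finite_simple_graph_def all_edges_def by blast
  hence "edges (induced G A) \<inter> edges (induced G B) = {}"
    using AB(1) by (auto simp: induced_def)
  moreover have "edges G = edges (induced G A) \<union> edges (induced G B)"
    using AB(3) by (auto simp: induced_def)
  moreover have "finite (edges G)" using s by (rule finite_edges)
  ultimately show "card (edges G) = card (edges (induced G A)) + card (edges (induced G B))"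
    by (metis card_Un_disjoint finite_Un)
  have "finite A" "finite B"
    using s AB(2) unfolding finite_simple_graph_def by (metis finite_Un)+
  thus "card (verts G) + 1 = card A + card B"
    using card_Un_Int[of A B] AB by simp
qed

section \<open>Ears and cycles through an edge\<close>

lemma path_edges_Nil [simp]: "path_edges [] = {}"
  and path_edges_single [simp]: "path_edges [x] = {}"
  by (simp_all add: path_edges_def)

lemma path_edges_Cons_Cons [simp]:
  "path_edges (x # y # zs) = insert {x, y} (path_edges (y # zs))"
proof -
  have "{x, y} \<in> path_edges (x # y # zs)"
    unfolding path_edges_def by (force intro: exI[of _ 0])
  moreover have "e \<in> path_edges (x # y # zs)" if "e \<in> path_edges (y # zs)" for e
    using that unfolding path_edges_def by (force intro: exI[of _ "Suc _"])
  moreover have "e = {x, y} \<or> e \<in> path_edges (y # zs)" if e: "e \<in> path_edges (x # y # zs)" for e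
  proof -
    obtain i where i: "e = {(x # y # zs) ! i, (x # y # zs) ! Suc i}" "Suc i < length (x # y # zs)"
      using e unfolding path_edges_def by blast
    show ?thesis
    proof (cases i)
      case (Suc j)
      with i have "e = {(y # zs) ! j, (y # zs) ! Suc j}" "Suc j < length (y # zs)" by simp_all
      thus ?thesis unfolding path_edges_def by blast
    qed (use i in simp)
  qed
  ultimately show ?thesis by blast
qed

lemma path_edges_append:
  "xs \<noteq> [] \<Longrightarrow> ys \<noteq> [] \<Longrightarrow>
    path_edges (xs @ ys) = path_edges xs \<union> insert {last xs, hd ys} (path_edges ys)"
proof (induction xs)
  case (Cons x xs)
  show ?case
  proof (cases xs)
    case Nil
    with Cons.prems show ?thesis by (cases ys) auto
  next
    case (Cons z zs)
    with Cons.IH Cons.prems show ?thesis by auto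
  qed
qed simp

lemma path_edges_rev [simp]: "path_edges (rev xs) = path_edges xs"
proof (induction xs)
  case (Cons x xs)
  show ?case
  proof (cases xs)
    case (Cons y ys)
    with Cons.IH path_edges_append[of "rev xs" "[x]"] show ?thesis
      by (simp add: last_rev insert_commute)
  qed simp
qed simp

lemma finite_path_edges [simp]: "finite (path_edges xs)"
  by (induction xs rule: induct_list012) auto

lemma card_path_edges_le: "card (path_edges xs) \<le> length xs - 1"
  by (induction xs rule: induct_list012) (auto intro: order_trans[OF card_insert_le_m1] simp: card_insert_if)

lemma path_edges_subset: "e \<in> path_edges xs \<Longrightarrow> e \<subseteq> set xs"
  by (induction xs rule: induct_list012) auto

definition cycle_edges :: "'a list \<Rightarrow> 'a set set" where
  "cycle_edges xs = insert {last xs, hd xs} (path_edges xs)"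

lemma is_cycle_alt:
  "is_cycle G C \<longleftrightarrow> C \<subseteq> edges G \<and> (\<exists>xs. distinct xs \<and> 3 \<le> length xs \<and> C = cycle_edges xs)"
  unfolding is_cycle_def cycle_edges_def by (rule refl)

text \<open>The path is kept free of repetitions during the induction by cutting it back whenever
  the walk returns to it. The last clause keeps it among the reachable vertices, which later makes
  the interior of an ear avoid the old vertices.\<close>

lemma rtrancl_distinct_path:
  assumes "(x, y) \<in> r\<^sup>*"
  shows "\<exists>p. p \<noteq> [] \<and> distinct p \<and> hd p = x \<and> last p = y \<and> path_edges p \<subseteq> (\<lambda>(a, b). {a, b}) ` r
    \<and> set p \<subseteq> r\<^sup>* `` {x}"
  using assms
proof induction
  case base
  show ?case by (rule exI[of _ "[x]"]) auto
next
  case (step y z)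
  then obtain p where p: "p \<noteq> []" "distinct p" "hd p = x" "last p = y"
      "path_edges p \<subseteq> (\<lambda>(a, b). {a, b}) ` r" "set p \<subseteq> r\<^sup>* `` {x}"
    by blast
  show ?case
  proof (cases "z \<in> set p")
    case True
    then obtain a b where ab: "p = (a @ [z]) @ b" by (metis append.assoc append_Cons append_Nil split_list)
    have "path_edges (a @ [z]) \<subseteq> path_edges p"
      unfolding ab by (cases "b = []") (simp_all add: path_edges_append del: append_assoc, blast)
    thus ?thesis using p ab by (intro exI[of _ "a @ [z]"]) (auto simp: hd_append split: if_splits)
  next
    case False
    have "(x, z) \<in> r\<^sup>*" using step.hyps by (rule rtrancl_into_rtrancl)
    moreover have "{y, z} \<in> (\<lambda>(a, b). {a, b}) ` r" using step.hyps(2) by force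
    ultimately show ?thesis
      using False p by (intro exI[of _ "p @ [z]"]) (auto simp: path_edges_append)
  qed
qed

text \<open>Disjoint paths join \<open>{u, v}\<close> to \<open>{x, y}\<close> inside \<open>(W, F)\<close>, so an ear attached at \<open>x\<close> and \<open>y\<close>
  closes a cycle through \<open>{u, v}\<close>. That all pairs are linked survives the addition of ears.\<close>
definition linked :: "'a set set \<Rightarrow> 'a set \<Rightarrow> 'a \<Rightarrow> 'a \<Rightarrow> 'a \<Rightarrow> 'a \<Rightarrow> bool" where
  "linked F W u v x y \<longleftrightarrow> (\<exists>p q. p \<noteq> [] \<and> q \<noteq> [] \<and> hd p = u \<and> last q = v \<and> distinct (p @ q) \<and>
     set (p @ q) \<subseteq> W \<and> path_edges p \<subseteq> F \<and> path_edges q \<subseteq> F \<and>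
     (last p = x \<and> hd q = y \<or> last p = y \<and> hd q = x))"

lemma linked_sym: "linked F W u v x y \<Longrightarrow> linked F W u v y x"
  unfolding linked_def by blast

lemma linked_extend_aux:
  assumes p: "p \<noteq> []" "distinct p" "path_edges p \<subseteq> F" "set p \<subseteq> W"
    and r: "distinct r" "set r \<inter> W = {}" "path_edges (last p # r) \<subseteq> F'" and "F \<subseteq> F'"
  shows "distinct (p @ r)" "path_edges (p @ r) \<subseteq> F'" "last (p @ r) = last (last p # r)"
proof -
  show "distinct (p @ r)" using p r by auto
  show "path_edges (p @ r) \<subseteq> F'"
    using p r \<open>F \<subseteq> F'\<close> by (cases r) (auto simp: path_edges_append)
qed simp

text \<open>Both paths are prolonged outside \<open>W\<close> at their free ends, from
  \<open>x\<close> to \<open>a\<close> and from \<open>y\<close> to \<open>b\<close>; disjointness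
  of \<open>r\<close> and \<open>s\<close> keeps them disjoint.\<close>

lemma linked_extend:
  assumes "linked F W u v x y" "F \<subseteq> F'" "W \<subseteq> W'"
    and r: "distinct r" "set r \<inter> W = {}" "path_edges (x # r) \<subseteq> F'" "last (x # r) = a" "set r \<subseteq> W'"
    and s: "distinct s" "set s \<inter> W = {}" "path_edges (y # s) \<subseteq> F'" "last (y # s) = b" "set s \<subseteq> W'"
    and rs: "set r \<inter> set s = {}"
  shows "linked F' W' u v a b"
proof -
  obtain p q where pq: "p \<noteq> []" "q \<noteq> []" "hd p = u" "last q = v" "distinct p" "distinct q"
      "set p \<inter> set q = {}" "set p \<subseteq> W" "set q \<subseteq> W" "path_edges p \<subseteq> F" "path_edges q \<subseteq> F"
    and xy: "last p = x \<and> hd q = y \<or> last p = y \<and> hd q = x"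
    using assms(1) unfolding linked_def by auto
  \<comment> \<open>Phrased with the free ends of \<open>p\<close> and \<open>q\<close> instead of
    \<open>x\<close> and \<open>y\<close>, so that it serves both ways in which the pair can be
    attached.\<close>
  have gen: "linked F' W' u v (last (last p # r')) (last (hd q # s'))"
    if "distinct r'" "set r' \<inter> W = {}" "path_edges (last p # r') \<subseteq> F'" "set r' \<subseteq> W'"
      "distinct s'" "set s' \<inter> W = {}" "path_edges (hd q # s') \<subseteq> F'" "set s' \<subseteq> W'"
      "set r' \<inter> set s' = {}" for r' s'
  proof -
    note 1 = linked_extend_aux[OF pq(1,5,10,8) that(1-3) assms(2)]
    have lq: "last (rev q) = hd q" using pq(2) by (simp add: last_rev)
    have 2: "distinct (rev q @ s')" "path_edges (rev q @ s') \<subseteq> F'"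
        "last (rev q @ s') = last (hd q # s')"
      using linked_extend_aux[of "rev q" F W s' F'] pq that assms(2) unfolding lq by auto
    \<comment> \<open>The free end of \<open>q\<close> is its head, so the prolongation is made on
      the reversed list.\<close>
    let ?q = "rev (rev q @ s')"
    have "hd ?q = last (hd q # s')" using 2(3) pq(2) by (subst hd_rev) auto
    moreover have "last ?q = v" using pq(2,4) by simp
    moreover have "path_edges ?q \<subseteq> F'" "distinct ?q" using 2 by (simp_all only: path_edges_rev distinct_rev)
    moreover have "set (p @ r') \<inter> set ?q = {}" using pq that by auto
    moreover have "set (p @ r') \<union> set ?q \<subseteq> W'" using pq that assms(3) by auto
    moreover have "hd (p @ r') = u" "p @ r' \<noteq> []" "?q \<noteq> []" using pq by auto
    ultimately show ?thesis unfolding linked_def using 1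
      by (intro exI[of _ "p @ r'"] exI[of _ ?q]) (auto simp del: rev_append)
  qed
  from xy show ?thesis
  proof
    assume "last p = x \<and> hd q = y"
    thus ?thesis using gen[of r s] r s rs by auto
  next
    assume "last p = y \<and> hd q = x"
    thus ?thesis using gen[of s r] r s rs by (auto intro: linked_sym simp: Int_commute)
  qed
qed

section \<open>Ears and the cycles that they close\<close>

definition is_ear :: "'a set \<Rightarrow> 'a set set \<Rightarrow> 'a \<Rightarrow> 'a list \<Rightarrow> 'a \<Rightarrow> bool" where
  "is_ear W F x m y \<longleftrightarrow> x \<in> W \<and> y \<in> W \<and> x \<noteq> y \<and> distinct m \<and> set m \<inter> W = {} \<and>
     path_edges (x # m @ [y]) \<inter> F = {}"

lemma is_ear_rev: "is_ear W F x m y \<Longrightarrow> is_ear W F y (rev m) x"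
proof -
  have "path_edges (y # rev m @ [x]) = path_edges (rev (x # m @ [y]))" by simp
  thus "is_ear W F x m y \<Longrightarrow> is_ear W F y (rev m) x"
    unfolding is_ear_def path_edges_rev by auto
qed

text \<open>Start from the pair x, b and walk along the ear from \<open>x\<close> to
  \<open>a\<close>. With b = x there would be no pair to start from.\<close>

lemma linked_add_ear_inner:
  assumes lk: "\<And>x y. x \<in> W \<Longrightarrow> y \<in> W \<Longrightarrow> x \<noteq> y \<Longrightarrow> linked F W u v x y"
    and ear: "is_ear W F x m y" and m: "m = m1 @ a # m2" and b: "b \<in> W" "b \<noteq> x"
  shows "linked (F \<union> path_edges (x # m @ [y])) (W \<union> set m) u v a b"
proof (rule linked_extend[of F W u v x b _ _ "m1 @ [a]" _ "[]"])
  have "path_edges ((x # m1 @ [a]) @ m2 @ [y]) =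
      path_edges (x # m1 @ [a]) \<union> insert {a, hd (m2 @ [y])} (path_edges (m2 @ [y]))"
    by (subst path_edges_append) auto
  thus "path_edges (x # m1 @ [a]) \<subseteq> F \<union> path_edges (x # m @ [y])" using m by auto
qed (use ear m b lk in \<open>auto simp: is_ear_def\<close>)

text \<open>If one vertex is on the ear, enter the ear at an end different from the other vertex. If
  both are on it, enter from both ends and stop at the first of the two that is met.\<close>

lemma linked_add_ear:
  assumes lk: "\<And>x y. x \<in> W \<Longrightarrow> y \<in> W \<Longrightarrow> x \<noteq> y \<Longrightarrow> linked F W u v x y"
    and ear: "is_ear W F x m y"
    and ab: "a \<in> W \<union> set m" "b \<in> W \<union> set m" "a \<noteq> b"
  shows "linked (F \<union> path_edges (x # m @ [y])) (W \<union> set m) u v a b"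
proof -
  let ?F = "F \<union> path_edges (x # m @ [y])" and ?W = "W \<union> set m"
  have xy: "x \<in> W" "y \<in> W" "x \<noteq> y" using ear unfolding is_ear_def by auto
  have rev: "path_edges (y # rev m @ [x]) = path_edges (x # m @ [y])"
    using path_edges_rev[of "x # m @ [y]"] by simp
  have one: "linked ?F ?W u v a b" if "a \<in> set m" "b \<in> W" for a b
  proof -
    obtain m1 m2 where m: "m = m1 @ a # m2" using \<open>a \<in> set m\<close> by (meson split_list)
    show ?thesis
    proof (cases "b = x")
      case False
      with linked_add_ear_inner[OF lk ear m \<open>b \<in> W\<close>] show ?thesis by blast
    next
      case True
      have "rev m = rev m2 @ a # rev m1" using m by simp
      from linked_add_ear_inner[OF lk is_ear_rev[OF ear] this \<open>b \<in> W\<close>] True xy(3)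
      show ?thesis unfolding rev by simp
    qed
  qed
  \<comment> \<open>Since \<open>a\<close> precedes \<open>b\<close>, the walk from \<open>x\<close>
    to \<open>a\<close> and the walk back from \<open>y\<close> to \<open>b\<close> are
    disjoint.\<close>
  have two: "linked ?F ?W u v a b" if m: "m = m1 @ a # m2 @ b # m3" for a b m1 m2 m3
  proof (rule linked_extend[of F W u v x y _ _ "m1 @ [a]" _ "rev (b # m3)"])
    have "path_edges ((x # m1 @ [a]) @ m2 @ b # m3 @ [y]) =
        path_edges (x # m1 @ [a]) \<union> insert {a, hd (m2 @ b # m3 @ [y])} (path_edges (m2 @ b # m3 @ [y]))"
      by (subst path_edges_append) auto
    thus "path_edges (x # m1 @ [a]) \<subseteq> ?F" using m by auto
    have "path_edges ((x # m1 @ a # m2) @ b # m3 @ [y]) =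
        path_edges (x # m1 @ a # m2) \<union> insert {last (x # m1 @ a # m2), b} (path_edges (b # m3 @ [y]))"
      by (subst path_edges_append) auto
    moreover have "path_edges (y # rev (b # m3)) = path_edges (b # m3 @ [y])"
      using path_edges_rev[of "b # m3 @ [y]"] by simp
    ultimately show "path_edges (y # rev (b # m3)) \<subseteq> ?F" using m by auto
  qed (use ear m lk xy in \<open>auto simp: is_ear_def\<close>)
  consider "a \<in> W" "b \<in> W" | "a \<in> set m" "b \<in> W" | "a \<in> W" "b \<in> set m" | "a \<in> set m" "b \<in> set m"
    using ab by blast
  thus ?thesis
  proof cases
    case 1
    show ?thesis
      by (rule linked_extend[OF lk[OF 1 ab(3)], of _ _ "[]" _ "[]"]) auto
  next
    case 4
    then obtain m1 m2 where m: "m = m1 @ a # m2" by (meson split_list)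
    hence "b \<in> set m1 \<or> b \<in> set m2" using 4 ab(3) by auto
    thus ?thesis
    proof
      assume "b \<in> set m2"
      then obtain m3 m4 where "m2 = m3 @ b # m4" by (meson split_list)
      hence "m = m1 @ a # m3 @ b # m4" using m by simp
      thus ?thesis by (rule two)
    next
      assume "b \<in> set m1"
      then obtain m3 m4 where "m1 = m3 @ b # m4" by (meson split_list)
      hence "m = m3 @ b # m4 @ a # m2" using m by simp
      from linked_sym[OF two[OF this]] show ?thesis .
    qed
  next
    case 2
    thus ?thesis by (rule one)
  next
    case 3
    thus ?thesis using linked_sym[OF one[of b a]] by simp
  qed
qed

text \<open>Go from \<open>u\<close> along \<open>p\<close>, through the ear, along \<open>q\<close>
  to \<open>v\<close>, and return by the edge {u, v}. The cycle is new because it uses ear edges,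
  which are not in \<open>F\<close>.\<close>

lemma ear_cycle:
  assumes lk: "linked F W u v x y" and ear: "is_ear W F x m y" and uv: "{u, v} \<in> F"
  obtains C where "{u, v} \<in> C" "\<not> C \<subseteq> F" "is_cycle (V, F \<union> path_edges (x # m @ [y])) C"
proof -
  obtain p q where pq: "p \<noteq> []" "q \<noteq> []" "hd p = u" "last q = v" "distinct (p @ q)"
      "set p \<subseteq> W" "set q \<subseteq> W" "path_edges p \<subseteq> F" "path_edges q \<subseteq> F"
    and xy: "last p = x \<and> hd q = y \<or> last p = y \<and> hd q = x"
    using lk unfolding linked_def by auto
  \<comment> \<open>The ear is oriented so that it runs from the end of \<open>p\<close> to the
    beginning of \<open>q\<close>.\<close>
  obtain x' y' m' where ear': "is_ear W F x' m' y'" "last p = x'" "hd q = y'"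
    and same: "path_edges (x' # m' @ [y']) = path_edges (x # m @ [y])"
  proof (cases "last p = x \<and> hd q = y")
    case False
    hence "last p = y" "hd q = x" using xy by auto
    thus ?thesis using that[OF is_ear_rev[OF ear]] path_edges_rev[of "x # m @ [y]"] by simp
  qed (use that[OF ear] in simp)
  let ?xs = "p @ m' @ q" and ?P = "path_edges (x' # m' @ [y'])"
  have P: "?P \<inter> F = {}" using ear'(1) unfolding is_ear_def by simp
  have ne: "?P \<noteq> {}" by (cases m') auto
  have pe: "path_edges ?xs = path_edges p \<union> ?P \<union> path_edges q"
  proof (cases "m' = []")
    case False
    have "?P = insert {x', hd m'} (insert {last m', y'} (path_edges m'))"
      using False path_edges_append[of "[x']" "m' @ [y']"] path_edges_append[of m' "[y']"] by auto
    moreover have "path_edges ?xs =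
        path_edges p \<union> insert {x', hd m'} (insert {last m', y'} (path_edges m' \<union> path_edges q))"
      using False pq(1,2) ear'(2,3) path_edges_append[of p "m' @ q"] path_edges_append[of m' q] by auto
    ultimately show ?thesis by auto
  qed (use pq(1,2) ear'(2,3) in \<open>auto simp: path_edges_append\<close>)
  \<comment> \<open>With only two vertices the ear would be the edge {u, v} itself, which already
    belongs to \<open>F\<close>.\<close>
  have len3: "3 \<le> length ?xs"
  proof (rule ccontr)
    assume "\<not> 3 \<le> length ?xs"
    moreover have "0 < length p" "0 < length q" using pq(1,2) by auto
    ultimately have "length p = 1" "length q = 1" "length m' = 0"
      unfolding length_append by linarith+
    hence len: "length p = 1" "length q = 1" "m' = []" by simp_all
    hence "p = [x']" "q = [y']" using ear' by (auto simp: length_Suc_conv)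
    hence "x' = u" "y' = v" using pq by auto
    hence "{u, v} \<in> ?P" using len(3) by simp
    thus False using P uv by blast
  qed
  have dist: "distinct ?xs" using pq ear'(1) unfolding is_ear_def by auto
  have ce: "cycle_edges ?xs = insert {u, v} (path_edges p \<union> ?P \<union> path_edges q)"
    unfolding cycle_edges_def pe using pq by (auto simp: insert_commute)
  have "cycle_edges ?xs \<subseteq> F \<union> path_edges (x # m @ [y])"
    unfolding ce using pq uv same by auto
  hence "is_cycle (V, F \<union> path_edges (x # m @ [y])) (cycle_edges ?xs)"
    unfolding is_cycle_alt snd_conv using len3 dist by (intro conjI exI[of _ ?xs]) simp_all
  moreover have "{u, v} \<in> cycle_edges ?xs" unfolding ce by simp
  moreover have "\<not> cycle_edges ?xs \<subseteq> F"
  proof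
    assume "cycle_edges ?xs \<subseteq> F"
    hence "?P \<subseteq> F" unfolding ce by simp
    thus False using P ne by blast
  qed
  ultimately show ?thesis using that[of "cycle_edges ?xs"] by simp
qed

text \<open>A missing edge inside \<open>W\<close> is an ear without interior. Otherwise leave
  \<open>W\<close> along an edge {w, z}; the region outside \<open>W\<close> reachable from
  \<open>z\<close> must touch \<open>W\<close> at a second vertex, for otherwise \<open>w\<close>
  would be a cut vertex.\<close>

lemma ear_exists:
  assumes simple: "finite_simple_graph G" and con: "connected_graph G" and ns: "nonseparable G"
    and W: "W \<subseteq> verts G" "2 \<le> card W" and F: "F \<subseteq> edges G" "F \<subseteq> Pow W" "F \<noteq> edges G"
  obtains x m y where "is_ear W F x m y" "path_edges (x # m @ [y]) \<subseteq> edges G" "set m \<subseteq> verts G"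
proof (cases "\<exists>f \<in> edges G - F. f \<subseteq> W")
  case True
  then obtain f where f: "f \<in> edges G" "f \<notin> F" "f \<subseteq> W" by blast
  then obtain x y where "f = {x, y}" "x \<noteq> y"
    using simple unfolding finite_simple_graph_def all_edges_def by blast
  thus ?thesis using f that[of x "[]" y] unfolding is_ear_def by auto
next
  case False
  obtain f where "f \<in> edges G" "f \<notin> F" using F by blast
  hence "\<not> f \<subseteq> W" using False by blast
  moreover have ev: "e \<subseteq> verts G" if "e \<in> edges G" for e
    using that simple unfolding finite_simple_graph_def all_edges_def by fast
  ultimately obtain t where t: "t \<in> verts G" "t \<notin> W" using \<open>f \<in> edges G\<close> by blast
  obtain s where s: "s \<in> W" using W(2) by fastforce
  have "(s, t) \<in> {(x, y). {x, y} \<in> edges G}\<^sup>*"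
    using con s t W(1) unfolding connected_graph_def by blast
  hence "t \<notin> W \<longrightarrow> (\<exists>w \<in> W. \<exists>z. z \<notin> W \<and> {w, z} \<in> edges G)"
    using s by (induction) auto
  then obtain w z where wz: "w \<in> W" "z \<notin> W" "{w, z} \<in> edges G" using t by blast
  \<comment> \<open>Steps that do not enter \<open>W\<close>: starting from \<open>z\<close>, they
    never leave the complement of \<open>W\<close>.\<close>
  define r where "r = {(x, y). {x, y} \<in> edges G \<and> y \<notin> W}"
  define R where "R = r\<^sup>* `` {z}"
  have RV: "x \<in> verts G \<and> x \<notin> W" if "x \<in> R" for x
  proof -
    have "(z, x) \<in> r\<^sup>*" using that by (simp add: R_def)
    thus ?thesis using wz ev by (induction) (auto simp: r_def)
  qed
  have "\<exists>c \<in> R. \<exists>y \<in> W - {w}. {c, y} \<in> edges G"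
  proof (rule ccontr)
    assume no: "\<not> ?thesis"
    \<comment> \<open>Without a second contact, the region \<open>R\<close> hangs at
      \<open>w\<close> alone. The other side is nontrivial because it contains all of
      \<open>W\<close>.\<close>
    have "split_at G w (insert w R) (verts G - R)"
      unfolding split_at_def
    proof (intro conjI ballI)
      show "insert w R \<union> (verts G - R) = verts G" using RV wz W(1) by auto
      show "insert w R \<inter> (verts G - R) = {w}" using RV wz W(1) by auto
      fix e assume e: "e \<in> edges G"
      have closed: "b \<in> insert w R" if "a \<in> R" "{a, b} \<in> edges G" for a b
      proof (cases "b \<in> W")
        case True
        thus ?thesis using no that by blast
      next
        case False
        hence "(a, b) \<in> r" using that by (simp add: r_def)
        thus ?thesis using that(1) unfolding R_def by (auto intro: rtrancl_into_rtrancl)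
      qed
      obtain a b where ab: "e = {a, b}"
        using e simple unfolding finite_simple_graph_def all_edges_def by blast
      show "e \<subseteq> insert w R \<or> e \<subseteq> verts G - R"
        using closed[of a b] closed[of b a] e ev[OF e] unfolding ab by (auto simp: insert_commute)
    qed
    moreover have fin: "finite (verts G)" using simple unfolding finite_simple_graph_def by simp
    have "2 \<le> card (insert w R)"
    proof -
      have "{w, z} \<subseteq> insert w R" "w \<noteq> z" using wz by (auto simp: R_def)
      moreover have "R \<subseteq> verts G" using RV by blast
      hence "finite (insert w R)" using fin by (simp add: finite_subset)
      ultimately show ?thesis using card_mono[of "insert w R" "{w, z}"] by simp
    qed
    moreover have "2 \<le> card (verts G - R)"
    proof -
      have "W \<subseteq> verts G - R" using RV W(1) by auto
      thus ?thesis using card_mono[of "verts G - R" W] fin W(2) by simp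
    qed
    ultimately show False using ns unfolding nonseparable_def by blast
  qed
  then obtain c y where cy: "c \<in> R" "y \<in> W" "y \<noteq> w" "{c, y} \<in> edges G" by blast
  have "(z, c) \<in> r\<^sup>*" using cy(1) by (simp add: R_def)
  from rtrancl_distinct_path[OF this] obtain m where m: "m \<noteq> []" "distinct m" "hd m = z" "last m = c"
      "path_edges m \<subseteq> (\<lambda>(a, b). {a, b}) ` r" "set m \<subseteq> R"
    unfolding R_def by blast
  have mE: "path_edges m \<subseteq> edges G" using m(5) by (auto simp: r_def)
  have pe: "path_edges (w # m @ [y]) = insert {w, z} (insert {c, y} (path_edges m))"
    using m path_edges_append[of "[w]" "m @ [y]"] path_edges_append[of m "[y]"] by auto
  have "path_edges (w # m @ [y]) \<subseteq> edges G" unfolding pe using mE wz cy by auto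
  \<comment> \<open>Every edge of this ear has an end in \<open>R\<close>, hence outside
    \<open>W\<close>, while all edges of \<open>F\<close> lie inside \<open>W\<close>.\<close>
  moreover have "e \<notin> F" if "e \<in> path_edges (w # m @ [y])" for e
  proof -
    have "\<not> e \<subseteq> W"
      using that path_edges_subset[of e m] wz(2) RV[OF cy(1)] m(5,6) RV
      unfolding pe by (auto simp: r_def)
    thus ?thesis using F(2) by blast
  qed
  ultimately show ?thesis
    using that[of w m y] wz cy m RV unfolding is_ear_def by blast
qed

text \<open>The bound is an equality for the edge {u, v} alone, with 1 + 1 = 2 + 0. An ear with l
  interior vertices adds l vertices, at most l + 1 edges and at least one cycle through {u, v}, so
  the bound persists.\<close>

lemma card_cycles_through_edge_ge:
  assumes simple: "finite_simple_graph G" and con: "connected_graph G" and ns: "nonseparable G"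
    and uv: "{u, v} \<in> edges G"
  shows "card (edges G) + 1 \<le> card (verts G) + card {C. is_cycle G C \<and> {u, v} \<in> C}"
proof -
  have fin: "finite (verts G)" using simple unfolding finite_simple_graph_def by simp
  have finE: "finite (edges G)" using simple by (rule finite_edges)
  have uvV: "u \<in> verts G" "v \<in> verts G" "u \<noteq> v"
    using uv simple unfolding finite_simple_graph_def all_edges_def by (auto simp: doubleton_eq_iff)
  define Z where "Z F = {C. is_cycle (verts G, F) C \<and> {u, v} \<in> C}" for F
  define inv where "inv W F \<longleftrightarrow> u \<in> W \<and> v \<in> W \<and> W \<subseteq> verts G \<and> F \<subseteq> edges G \<and> F \<subseteq> Pow W \<and>
    {u, v} \<in> F \<and> (\<forall>x \<in> W. \<forall>y \<in> W. x \<noteq> y \<longrightarrow> linked F W u v x y) \<and>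
    card F + 1 \<le> card W + card (Z F)" for W F
  have finZ: "finite (Z F)" if "F \<subseteq> edges G" for F
    unfolding Z_def is_cycle_alt using finite_subset[OF that finE]
    by (auto intro: finite_subset[of _ "Pow F"])
  have base: "inv {u, v} {{u, v}}"
  proof -
    have "linked {{u, v}} {u, v} u v u v"
      unfolding linked_def by (rule exI[of _ "[u]"], rule exI[of _ "[v]"]) (use uvV in auto)
    thus ?thesis unfolding inv_def using uv uvV linked_sym by fastforce
  qed
  have step: "\<exists>W' F'. inv W' F' \<and> F \<subset> F'" if i: "inv W F" and F: "F \<noteq> edges G" for W F
  proof -
    have W: "W \<subseteq> verts G" and FE: "F \<subseteq> edges G" and FW: "F \<subseteq> Pow W" and "u \<in> W" "v \<in> W"
      and uvF: "{u, v} \<in> F"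
      and lk: "\<And>x y. x \<in> W \<Longrightarrow> y \<in> W \<Longrightarrow> x \<noteq> y \<Longrightarrow> linked F W u v x y"
      and cnt: "card F + 1 \<le> card W + card (Z F)"
      using i unfolding inv_def by auto
    have finW: "finite W" using fin W by (rule rev_finite_subset)
    have "card {u, v} \<le> card W" using finW \<open>u \<in> W\<close> \<open>v \<in> W\<close> by (intro card_mono) auto
    hence "2 \<le> card W" using uvV by simp
    from ear_exists[OF simple con ns W this FE FW F] obtain x m y where
      ear: "is_ear W F x m y" and PE: "path_edges (x # m @ [y]) \<subseteq> edges G" and mV: "set m \<subseteq> verts G"
      by blast
    let ?P = "path_edges (x # m @ [y])"
    have xy: "x \<in> W" "y \<in> W" "x \<noteq> y" and m: "distinct m" "set m \<inter> W = {}" and P: "?P \<inter> F = {}"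
      using ear unfolding is_ear_def by auto
    obtain C where C: "{u, v} \<in> C" "\<not> C \<subseteq> F" "is_cycle (verts G, F \<union> ?P) C"
      using ear_cycle[OF lk[OF xy] ear uvF] by blast
    have "Z F \<subseteq> Z (F \<union> ?P)" unfolding Z_def using is_cycle_mono by fastforce
    moreover have "C \<in> Z (F \<union> ?P)" "C \<notin> Z F" using C by (auto simp: Z_def is_cycle_alt)
    ultimately have "Z F \<subset> Z (F \<union> ?P)" by blast
    hence "card (Z F) < card (Z (F \<union> ?P))"
      using finZ[of "F \<union> ?P"] FE PE by (intro psubset_card_mono) auto
    moreover have "card (W \<union> set m) = card W + length m"
      using finW m by (subst card_Un_disjoint) (auto simp: distinct_card)
    moreover have "card (F \<union> ?P) \<le> card F + (length m + 1)"
      using card_Un_le[of F ?P] card_path_edges_le[of "x # m @ [y]"] by simp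
    ultimately have "card (F \<union> ?P) + 1 \<le> card (W \<union> set m) + card (Z (F \<union> ?P))" using cnt by linarith
    moreover have "linked (F \<union> ?P) (W \<union> set m) u v a b"
      if "a \<in> W \<union> set m" "b \<in> W \<union> set m" "a \<noteq> b" for a b
      by (rule linked_add_ear[OF lk ear that])
    moreover have "?P \<subseteq> Pow (W \<union> set m)"
      using path_edges_subset[of _ "x # m @ [y]"] xy by fastforce
    ultimately have "inv (W \<union> set m) (F \<union> ?P)"
      unfolding inv_def using W FE FW \<open>u \<in> W\<close> \<open>v \<in> W\<close> uvF mV PE
      by (intro conjI ballI impI) auto
    moreover have "?P \<noteq> {}" by (cases m) auto
    hence "F \<subset> F \<union> ?P" using P by blast
    ultimately show ?thesis by blast
  qed
  have "\<exists>W. inv W (edges G)"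
  proof -
    \<comment> \<open>Among the finitely many edge sets satisfying the invariant, a maximal one
      admits no further ear, so it is the whole edge set.\<close>
    let ?S = "{F. \<exists>W. inv W F}"
    have fin: "finite ?S"
      by (rule finite_subset[of _ "Pow (edges G)"]) (auto simp: inv_def finE)
    have ne: "?S \<noteq> {}" using base by blast
    obtain F where F: "F \<in> ?S" and max: "\<forall>F' \<in> ?S. F \<subseteq> F' \<longrightarrow> F = F'"
      using finite_has_maximal[OF fin ne] by (elim bexE)
    from F obtain W where W: "inv W F" by blast
    have "F = edges G"
    proof (rule ccontr)
      assume "F \<noteq> edges G"
      from step[OF W this] obtain W' F' where "inv W' F'" "F \<subset> F'" by (elim exE conjE)
      thus False using max by blast
    qed
    thus ?thesis using W by blast
  qed
  then obtain W where W: "W \<subseteq> verts G" "card (edges G) + 1 \<le> card W + card (Z (edges G))"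
    unfolding inv_def by blast
  moreover have "card W \<le> card (verts G)" using fin W(1) by (rule card_mono)
  moreover have "Z (edges G) = {C. is_cycle G C \<and> {u, v} \<in> C}"
    unfolding Z_def is_cycle_def by simp
  ultimately show ?thesis by simp
qed

section \<open>Large 4-cacti\<close>

lemma cycle_edges_append_commute:
  assumes "p \<noteq> []" "q \<noteq> []"
  shows "cycle_edges (q @ p) = cycle_edges (p @ q)"
proof -
  have "path_edges (q @ p) = path_edges q \<union> insert {last q, hd p} (path_edges p)"
    "path_edges (p @ q) = path_edges p \<union> insert {last p, hd q} (path_edges q)"
    using assms path_edges_append by blast+
  thus ?thesis using assms unfolding cycle_edges_def by auto
qed

lemma cycle_edges_rev: "cycle_edges (rev xs) = cycle_edges xs"
  unfolding cycle_edges_def by (cases "xs = []") (simp_all add: last_rev hd_rev insert_commute)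

lemma cycle_edges_subset: "xs \<noteq> [] \<Longrightarrow> e \<in> cycle_edges xs \<Longrightarrow> e \<subseteq> set xs"
  unfolding cycle_edges_def using path_edges_subset[of e xs] by auto

text \<open>Rotation moves the chosen edge to the closing position and reversal fixes its direction.
  Cycles through {a, b} can then be counted as paths from \<open>a\<close> to
  \<open>b\<close>.\<close>

lemma cycle_edges_normalize:
  assumes "distinct xs" "3 \<le> length xs" "{a, b} \<in> cycle_edges xs"
  obtains ys where "distinct ys" "set ys = set xs" "3 \<le> length ys" "cycle_edges ys = cycle_edges xs"
    "hd ys = a" "last ys = b"
proof -
  have "\<exists>ys. distinct ys \<and> set ys = set xs \<and> 3 \<le> length ys \<and> cycle_edges ys = cycle_edges xs
    \<and> {hd ys, last ys} = {a, b}"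
  proof (cases "{a, b} = {last xs, hd xs}")
    case True
    thus ?thesis using assms by (intro exI[of _ xs]) auto
  next
    case False
    hence "{a, b} \<in> path_edges xs" using assms(3) by (simp add: cycle_edges_def)
    then obtain i where i: "{a, b} = {xs ! i, xs ! Suc i}" "Suc i < length xs"
      unfolding path_edges_def by blast
    let ?p = "take (Suc i) xs" and ?q = "drop (Suc i) xs"
    have ne: "?p \<noteq> []" "?q \<noteq> []" using i(2) by auto
    have "last (?q @ ?p) = xs ! i" using i(2) ne by (simp add: take_Suc_conv_app_nth)
    moreover have "hd (?q @ ?p) = xs ! Suc i" using i(2) by (simp add: hd_drop_conv_nth)
    moreover have "cycle_edges (?q @ ?p) = cycle_edges xs"
      using cycle_edges_append_commute[OF ne] by simp
    moreover have "mset (?q @ ?p) = mset xs"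
      by (metis append_take_drop_id mset_append union_commute)
    hence "distinct (?q @ ?p)" "set (?q @ ?p) = set xs" "length (?q @ ?p) = length xs"
      using assms(1) by (metis mset_eq_imp_distinct_iff, metis mset_eq_setD, metis size_mset)
    ultimately show ?thesis using i(1) assms(2) by (intro exI[of _ "?q @ ?p"]) auto
  qed
  then obtain ys where ys: "distinct ys" "set ys = set xs" "3 \<le> length ys"
      "cycle_edges ys = cycle_edges xs" "{hd ys, last ys} = {a, b}" by blast
  show ?thesis
  proof (cases "hd ys = a \<and> last ys = b")
    case True
    thus ?thesis using ys that by blast
  next
    case False
    hence "hd ys = b" "last ys = a" using ys(5) by (auto simp: doubleton_eq_iff)
    moreover have "ys \<noteq> []" using ys(3) by auto
    ultimately show ?thesis
      using ys that[of "rev ys"] by (simp add: cycle_edges_rev hd_rev last_rev)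
  qed
qed

text \<open>Consecutive edges share a vertex different from \<open>v\<close>. It lies on one side
  only, so both edges are on that side.\<close>

lemma path_in_one_side:
  assumes "A \<inter> B = {v}" "v \<notin> set ys" "set ys \<subseteq> A \<union> B" "\<And>e. e \<in> path_edges ys \<Longrightarrow> e \<subseteq> A \<or> e \<subseteq> B"
  shows "set ys \<subseteq> A \<or> set ys \<subseteq> B"
  using assms(2-4)
proof (induction ys rule: induct_list012)
  case (3 x y zs)
  have 1: "set (y # zs) \<subseteq> A \<or> set (y # zs) \<subseteq> B"
    using "3.prems" by (intro "3.IH"(2)) simp_all
  have 2: "{x, y} \<subseteq> A \<or> {x, y} \<subseteq> B" by (rule "3.prems"(3)) simp
  have "y \<noteq> v" using "3.prems"(1) by auto
  hence "y \<notin> A \<or> y \<notin> B" using assms(1) by blast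
  with 1 2 show ?case by simp blast
qed auto

text \<open>Deleting \<open>v\<close> from the cycle leaves a path that avoids \<open>v\<close> and
  therefore cannot change sides; \<open>v\<close> itself belongs to both.\<close>

lemma cycle_in_one_side:
  assumes split: "split_at G v A B" and "is_cycle G C"
  shows "C \<subseteq> edges (induced G A) \<or> C \<subseteq> edges (induced G B)"
proof -
  have AB: "A \<inter> B = {v}" "A \<union> B = verts G" and side: "\<And>e. e \<in> edges G \<Longrightarrow> e \<subseteq> A \<or> e \<subseteq> B"
    using split unfolding split_at_def by auto
  obtain xs where CE: "C \<subseteq> edges G" and xs: "distinct xs" "3 \<le> length xs" and C: "C = cycle_edges xs"
    using assms(2) unfolding is_cycle_alt by blast
  have ne: "xs \<noteq> []" using xs(2) by auto
  have V: "set xs \<subseteq> A \<union> B"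
  proof
    fix x assume "x \<in> set xs"
    then obtain i where i: "i < length xs" "x = xs ! i" by (metis in_set_conv_nth)
    have "\<exists>e \<in> cycle_edges xs. x \<in> e"
    proof (cases "Suc i < length xs")
      case True
      thus ?thesis using i unfolding cycle_edges_def path_edges_def by blast
    next
      case False
      hence "x = last xs" using i ne by (metis Suc_lessI diff_Suc_1 last_conv_nth)
      thus ?thesis unfolding cycle_edges_def by blast
    qed
    thus "x \<in> A \<union> B" using side CE C by blast
  qed
  have "set xs \<subseteq> A \<or> set xs \<subseteq> B"
  proof (cases "v \<in> set xs")
    case False
    thus ?thesis using V AB(1) side CE C unfolding cycle_edges_def by (intro path_in_one_side) auto
  next
    case True
    then obtain p q where pq: "xs = p @ v # q" by (meson split_list)
    \<comment> \<open>The list is rotated to begin with \<open>v\<close>, so that the rest is a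
      single path.\<close>
    have eq: "cycle_edges (v # q @ p) = cycle_edges xs"
      using cycle_edges_append_commute[of p "v # q"] pq by (cases p) auto
    have "q @ p \<noteq> []" using xs(2) pq by (cases p) auto
    hence "path_edges (q @ p) \<subseteq> path_edges (v # q @ p)"
      using path_edges_append[of "[v]" "q @ p"] by auto
    hence "path_edges (q @ p) \<subseteq> C" unfolding C eq[symmetric] by (auto simp: cycle_edges_def)
    moreover have "v \<notin> set (q @ p)" using xs(1) pq by auto
    moreover have "set (q @ p) \<subseteq> A \<union> B" using V pq by auto
    ultimately have "set (q @ p) \<subseteq> A \<or> set (q @ p) \<subseteq> B"
      using AB(1) side CE by (intro path_in_one_side) auto
    moreover have "set xs = insert v (set (q @ p))" using pq by auto
    moreover have "v \<in> A" "v \<in> B" using AB by auto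
    ultimately show ?thesis by auto
  qed
  moreover have "e \<subseteq> set xs" if "e \<in> C" for e using cycle_edges_subset[OF ne] that C by blast
  ultimately show ?thesis using CE unfolding induced_def by auto
qed

text \<open>An edge inside \<open>A\<close> is not an edge of the other part, so every cycle through
  it stays in \<open>A\<close> and no cycle is gained by gluing.\<close>

lemma card_cycles_split_le:
  assumes simple: "finite_simple_graph G" and split: "split_at G v A B"
    and k: "k_cactus k (induced G A)" and e: "e \<in> edges G" "e \<subseteq> A"
  shows "card {C. is_cycle G C \<and> e \<in> C} \<le> k"
proof -
  have AB: "A \<inter> B = {v}" using split unfolding split_at_def by auto
  have "\<not> e \<subseteq> {v}"
    using simple e unfolding finite_simple_graph_def all_edges_def by blast
  hence "e \<notin> edges (induced G B)" using e AB unfolding induced_def by auto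
  hence "{C. is_cycle G C \<and> e \<in> C} \<subseteq> {C. is_cycle (induced G A) C \<and> e \<in> C}"
    using cycle_in_one_side[OF split] unfolding is_cycle_alt by blast
  moreover have "e \<in> edges (induced G A)" "finite_simple_graph (induced G A)"
    using e k unfolding induced_def k_cactus_def by auto
  ultimately show ?thesis
    using k finite_cycles[of "induced G A" e] unfolding k_cactus_def by (meson card_mono order_trans)
qed

lemma k_cactus_split:
  assumes simple: "finite_simple_graph G" and split: "split_at G v A B"
    and kA: "k_cactus k (induced G A)" and kB: "k_cactus k (induced G B)"
  shows "k_cactus k G"
proof -
  have AB: "A \<inter> B = {v}" "A \<union> B = verts G" and side: "\<And>e. e \<in> edges G \<Longrightarrow> e \<subseteq> A \<or> e \<subseteq> B"
    using split unfolding split_at_def by auto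
  let ?S = "{(x, y). {x, y} \<in> edges G}"
  have sub: "{(x, y). {x, y} \<in> edges (induced G D)} \<subseteq> ?S" for D by (auto simp: induced_def)
  have con: "(x, y) \<in> ?S\<^sup>*" if "x \<in> D" "y \<in> D" "k_cactus k (induced G D)" for x y D
  proof -
    have "(x, y) \<in> {(x, y). {x, y} \<in> edges (induced G D)}\<^sup>*"
      using that unfolding k_cactus_def connected_graph_def by (simp add: induced_def)
    thus ?thesis using rtrancl_mono[OF sub] by blast
  qed
  have "(x, v) \<in> ?S\<^sup>* \<and> (v, x) \<in> ?S\<^sup>*" if "x \<in> verts G" for x
    using that con[OF _ _ kA] con[OF _ _ kB] AB by blast
  hence "connected_graph G" unfolding connected_graph_def by (meson rtrancl_trans)
  moreover have "card {C. is_cycle G C \<and> e \<in> C} \<le> k" if "e \<in> edges G" for e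
    using side[OF that] card_cycles_split_le[OF simple split kA that]
      card_cycles_split_le[OF simple split_at_sym[OF split] kB that] by blast
  ultimately show ?thesis using simple unfolding k_cactus_def by blast
qed

section \<open>A construction attaining the bound\<close>

lemma card_all_edges:
  assumes "finite V"
  shows "card (all_edges V) = card V choose 2"
proof -
  have "all_edges V = {e. e \<subseteq> V \<and> card e = 2}"
    unfolding all_edges_def card_2_iff by blast
  thus ?thesis using n_subsets[OF assms, of 2] by simp
qed

text \<open>A cycle through {a, b} is determined by its interior, a nonempty list without repetition
  of the at most two other vertices; there are at most four such lists.\<close>

lemma k_cactus_complete:
  assumes "finite V" "card V \<le> 4"
  shows "k_cactus 4 (V, all_edges V)"
proof -
  have "card {C. is_cycle (V, all_edges V) C \<and> e \<in> C} \<le> 4" if e: "e \<in> all_edges V" for e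
  proof -
    obtain a b where ab: "e = {a, b}" "a \<in> V" "b \<in> V" "a \<noteq> b"
      using e unfolding all_edges_def by blast
    have "card (V - {a, b}) \<le> 2" using ab assms by (simp add: card_Diff_subset)
    \<comment> \<open>With fewer than four vertices, \<open>c\<close> and \<open>d\<close> may
      coincide or lie outside \<open>V\<close>; this is harmless for an upper bound.\<close>
    then obtain c d where cd: "V - {a, b} \<subseteq> {c, d}"
    proof -
      consider "card (V - {a, b}) = 0" | "card (V - {a, b}) = 1" | "card (V - {a, b}) = 2"
        using \<open>card (V - {a, b}) \<le> 2\<close> by linarith
      thus ?thesis
        using that assms(1) by cases (auto simp: card_1_singleton_iff card_2_iff)
    qed
    let ?M = "{[c], [d], [c, d], [d, c]}"
    have "C \<in> (\<lambda>m. cycle_edges (a # m @ [b])) ` ?M"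
      if C: "is_cycle (V, all_edges V) C" "e \<in> C" for C
    proof -
      obtain xs where xs: "distinct xs" "3 \<le> length xs" "C = cycle_edges xs"
        and sub: "C \<subseteq> all_edges V"
        using C(1) unfolding is_cycle_alt by auto
      have "{a, b} \<in> cycle_edges xs" using C(2) xs(3) ab(1) by simp
      from cycle_edges_normalize[OF xs(1,2) this] obtain ys where
        ys: "distinct ys" "3 \<le> length ys" "cycle_edges ys = cycle_edges xs" "hd ys = a" "last ys = b"
        by metis
      then obtain m where m: "ys = a # m @ [b]"
        using ab(4) by (cases ys; cases "tl ys" rule: rev_cases) auto
      hence ne: "m \<noteq> []" using ys(2) by auto
      have "set m \<subseteq> V"
      proof
        fix x assume "x \<in> set m"
        then obtain i where i: "i < length m" "x = m ! i" by (metis in_set_conv_nth)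
        hence "Suc (Suc i) < length ys" "ys ! Suc i = x" using m by (auto simp: nth_append)
        hence "{x, ys ! Suc (Suc i)} \<in> path_edges ys" unfolding path_edges_def by blast
        hence "{x, ys ! Suc (Suc i)} \<in> cycle_edges ys"
          unfolding cycle_edges_def by (rule insertI2)
        hence "{x, ys ! Suc (Suc i)} \<in> C" using xs(3) ys(3) by simp
        hence "{x, ys ! Suc (Suc i)} \<in> all_edges V" using sub by (rule rev_subsetD)
        thus "x \<in> V" unfolding all_edges_def by (auto simp: doubleton_eq_iff)
      qed
      hence "set m \<subseteq> {c, d}" "distinct m" using ys(1) m cd by auto
      hence "m \<in> ?M" using ne
        by (cases m; cases "tl m"; cases "tl (tl m)") auto
      thus ?thesis using m ys(3) xs(3) by blast
    qed
    hence "{C. is_cycle (V, all_edges V) C \<and> e \<in> C} \<subseteq> (\<lambda>m. cycle_edges (a # m @ [b])) ` ?M" by blast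
    hence "card {C. is_cycle (V, all_edges V) C \<and> e \<in> C} \<le> card ?M"
      by (meson card_image_le card_mono finite.emptyI finite_imageI finite_insert order_trans)
    also have "\<dots> \<le> 4" using card_insert_le_m1 by (simp add: card_insert_if)
    finally show ?thesis .
  qed
  moreover have "connected_graph (V, all_edges V)"
    unfolding connected_graph_def all_edges_def by (auto intro: r_into_rtrancl)
  ultimately show ?thesis using assms(1) unfolding k_cactus_def finite_simple_graph_def by simp
qed

text \<open>The vertex set is prescribed because competitors live on the vertex type of the given
  graph, which may be finite. K_1 has defect 0, K_2 and K_3 have defect 1, and gluing on a K_4
  changes neither the defect nor the residue modulo 3.\<close>

lemma large_4_cactus_exists:
  assumes "finite V" "V \<noteq> {}"
  shows "\<exists>H. verts H = V \<and> k_cactus 4 H \<and>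
    2 * (card V - 1) \<le> card (edges H) + (if card V mod 3 = 1 then 0 else 1)"
  using assms
proof (induction "card V" arbitrary: V rule: less_induct)
  case less
  have pos: "0 < card V" using less.prems by (simp add: card_gt_0_iff)
  show ?case
  proof (cases "card V \<le> 3")
    case True
    hence "k_cactus 4 (V, all_edges V)" using less.prems by (intro k_cactus_complete) auto
    moreover have "card V = 1 \<or> card V = 2 \<or> card V = 3" using True pos by linarith
    hence "2 * (card V - 1) \<le> card (all_edges V) + (if card V mod 3 = 1 then 0 else 1)"
      using card_all_edges[OF less.prems(1)] by (auto simp: choose_two)
    ultimately show ?thesis by (intro exI[of _ "(V, all_edges V)"]) simp
  next
    case False
    \<comment> \<open>\<open>D\<close> is set aside as three vertices of a new K_4, whose fourth
      vertex \<open>v\<close> is taken from the smaller cactus.\<close>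
    then obtain D where D: "D \<subseteq> V" "card D = 3" "finite D"
      using obtain_subset_with_card_n[of 3 V] by auto
    have cVD: "card (V - D) = card V - 3" using D by (simp add: card_Diff_subset)
    hence ne: "V - D \<noteq> {}" using False by (metis card.empty diff_is_0_eq)
    then obtain v where v: "v \<in> V" "v \<notin> D" by blast
    have "card (V - D) < card V" using cVD False by simp
    from less.hyps[OF this finite_Diff[OF less.prems(1)] ne] obtain H' where H': "verts H' = V - D" "k_cactus 4 H'"
      "2 * (card (V - D) - 1) \<le> card (edges H') + (if card (V - D) mod 3 = 1 then 0 else 1)"
      by (elim exE conjE)
    have s': "edges H' \<subseteq> all_edges (V - D)"
      using H' unfolding k_cactus_def finite_simple_graph_def by simp
    define H where "H = (V, edges H' \<union> all_edges (insert v D))"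
    have sub1: "e \<subseteq> V - D" "\<not> e \<subseteq> {v}" if "e \<in> edges H'" for e
      using subsetD[OF s' that] unfolding all_edges_def by auto
    have sub2: "e \<subseteq> insert v D" "\<not> e \<subseteq> {v}" if "e \<in> all_edges (insert v D)" for e
      using that unfolding all_edges_def by auto
    have cap: "(V - D) \<inter> insert v D = {v}" using v by auto
    have "all_edges X \<subseteq> all_edges V" if "X \<subseteq> V" for X
      using that unfolding all_edges_def by blast
    hence "all_edges (V - D) \<subseteq> all_edges V" "all_edges (insert v D) \<subseteq> all_edges V"
      using v D by simp_all
    hence simple: "finite_simple_graph H"
      unfolding finite_simple_graph_def H_def using s' less.prems by simp
    have split: "split_at H v (V - D) (insert v D)"
      unfolding split_at_def H_def fst_conv snd_conv
    proof (intro conjI ballI)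
      show "V - D \<union> insert v D = V" using v D(1) by blast
      show "e \<subseteq> V - D \<or> e \<subseteq> insert v D" if "e \<in> edges H' \<union> all_edges (insert v D)" for e
        using that sub1(1)[of e] sub2(1)[of e] by blast
    qed (rule cap)
    have i1: "induced H (V - D) = H'"
    proof -
      have "e \<notin> all_edges (insert v D)" if "e \<subseteq> V - D" for e using that cap sub2[of e] by blast
      thus ?thesis unfolding induced_def H_def using sub1 H'(1) by (intro prod_eqI) auto
    qed
    have i2: "induced H (insert v D) = (insert v D, all_edges (insert v D))"
    proof -
      have "e \<notin> edges H'" if "e \<subseteq> insert v D" for e using that cap sub1[of e] by blast
      thus ?thesis unfolding induced_def H_def using sub2 by (intro prod_eqI) auto
    qed
    have c4: "card (insert v D) = 4" using v D by simp
    have "k_cactus 4 H"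
      using k_cactus_split[OF simple split, of 4] H'(2) k_cactus_complete[of "insert v D"] c4 D
      unfolding i1 i2 by simp
    moreover have "card (all_edges (insert v D)) = 6"
      using card_all_edges[of "insert v D"] D c4 by (simp add: choose_two)
    hence "card (edges H) = card (edges H') + 6"
      using card_edges_split(1)[OF simple split] unfolding i1 i2 by simp
    moreover have "card V = card (V - D) + 3" using cVD False by simp
    hence "card (V - D) mod 3 = card V mod 3" by simp
    ultimately show ?thesis
      using H'(3) cVD False by (intro exI[of _ H]) (auto simp: H_def split: if_splits)
  qed
qed

section \<open>Certificates of five cycles through an edge\<close>

text \<open>Graphs on few vertices are described by a list \<open>L\<close> of their vertices and a list of index
  pairs \<open>(i, j)\<close> with \<open>i < j < length L\<close>.\<close>
definition edges_of :: "'a list \<Rightarrow> (nat \<times> nat) list \<Rightarrow> 'a set set" where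
  "edges_of L ps = (\<lambda>(i, j). {L ! i, L ! j}) ` set ps"

definition pairs :: "nat \<Rightarrow> (nat \<times> nat) list" where
  "pairs n = concat (map (\<lambda>j. map (\<lambda>i. (i, j)) [0..<j]) [0..<n])"

definition pairs_without :: "nat \<Rightarrow> (nat \<times> nat) list \<Rightarrow> (nat \<times> nat) list" where
  "pairs_without n ds = filter (\<lambda>p. p \<notin> set ds) (pairs n)"

text \<open>The rotated copy \<open>tl xs @ [hd xs]\<close> supplies the closing edge;
  \<open>min\<close> and \<open>max\<close> give each pair the increasing form used in
  \<open>pairs\<close>.\<close>

definition cycle_pairs :: "nat list \<Rightarrow> (nat \<times> nat) list" where
  "cycle_pairs xs = map (\<lambda>(i, j). (min i j, max i j)) (zip xs (tl xs @ [hd xs]))"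

text \<open>A refutation of the bound 4 that can be evaluated. Comparing sets of ordered index pairs
  identifies rotations and reversals, so the five lists stand for five different cycles.\<close>

definition five_cycles :: "nat \<Rightarrow> (nat \<times> nat) list \<Rightarrow> nat \<times> nat \<Rightarrow> nat list list \<Rightarrow> bool" where
  "five_cycles n ps e xss \<longleftrightarrow> length xss = 5 \<and> distinct (map (\<lambda>xs. set (cycle_pairs xs)) xss) \<and>
     e \<in> set ps \<and> set ps \<subseteq> set (pairs n) \<and>
     (\<forall>xs \<in> set xss. distinct xs \<and> 3 \<le> length xs \<and> (\<forall>x \<in> set xs. x < n) \<and>
        e \<in> set (cycle_pairs xs) \<and> set (cycle_pairs xs) \<subseteq> set ps)"

lemma set_pairs: "set (pairs n) = {(i, j). i < j \<and> j < n}"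
  unfolding pairs_def by auto

lemma inj_on_edge_of_pair:
  assumes "distinct L"
  shows "inj_on (\<lambda>(i, j). {L ! i, L ! j}) (set (pairs (length L)))"
proof (rule inj_onI)
  fix p q assume "p \<in> set (pairs (length L))" "q \<in> set (pairs (length L))"
    and eq: "(\<lambda>(i, j). {L ! i, L ! j}) p = (\<lambda>(i, j). {L ! i, L ! j}) q"
  then obtain i j k l where p: "p = (i, j)" "i < j" "j < length L" and q: "q = (k, l)" "k < l" "l < length L"
    unfolding set_pairs by blast
  have "{L ! i, L ! j} = {L ! k, L ! l}" using eq p(1) q(1) by simp
  hence "i = k \<and> j = l \<or> i = l \<and> j = k"
    unfolding doubleton_eq_iff using assms p q by (simp add: nth_eq_iff_index_eq)
  thus "p = q" using p q by auto
qed

lemma all_edges_eq_edges_of: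
  assumes "distinct L"
  shows "all_edges (set L) = edges_of L (pairs (length L))"
proof (intro equalityI subsetI)
  fix e assume "e \<in> all_edges (set L)"
  then obtain u v where "e = {u, v}" "u \<in> set L" "v \<in> set L" "u \<noteq> v" unfolding all_edges_def by blast
  then obtain i j where ij: "i < length L" "j < length L" "e = {L ! i, L ! j}" "i \<noteq> j"
    by (metis in_set_conv_nth)
  have "\<exists>p \<in> set (pairs (length L)). e = (\<lambda>(i, j). {L ! i, L ! j}) p"
  proof (cases "i < j")
    case True
    thus ?thesis using ij by (intro bexI[of _ "(i, j)"]) (auto simp: set_pairs)
  next
    case False
    thus ?thesis using ij by (intro bexI[of _ "(j, i)"]) (auto simp: set_pairs)
  qed
  thus "e \<in> edges_of L (pairs (length L))" unfolding edges_of_def by blast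
next
  fix e assume "e \<in> edges_of L (pairs (length L))"
  then obtain i j where ij: "i < j" "j < length L" "e = {L ! i, L ! j}"
    unfolding edges_of_def set_pairs by auto
  have "L ! i \<noteq> L ! j" using assms ij by (simp add: nth_eq_iff_index_eq)
  thus "e \<in> all_edges (set L)" unfolding all_edges_def using ij nth_mem by fastforce
qed

lemma all_edges_diff:
  assumes "distinct L" "set ds \<subseteq> set (pairs (length L))"
  shows "all_edges (set L) - edges_of L ds = edges_of L (pairs_without (length L) ds)"
proof -
  have "set (pairs_without (length L) ds) = set (pairs (length L)) - set ds"
    unfolding pairs_without_def by auto
  thus ?thesis
    unfolding all_edges_eq_edges_of[OF assms(1)] edges_of_def
    using inj_on_image_set_diff[OF inj_on_edge_of_pair[OF assms(1)] Diff_subset assms(2)] by simp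
qed

text \<open>The closing vertex \<open>z\<close> is kept apart from the head \<open>x\<close>, since
  the head changes in the induction while the closing vertex must not.\<close>

lemma path_edges_map_zip:
  "(\<lambda>(i, j). {f i, f j}) ` set (zip (x # ys) (ys @ [z])) =
    insert {f (last (x # ys)), f z} (path_edges (map f (x # ys)))"
proof (induction ys arbitrary: x)
  case (Cons y ys)
  show ?case using Cons[of y] by (simp add: insert_commute)
qed simp

lemma cycle_edges_map:
  assumes "xs \<noteq> []"
  shows "cycle_edges (map f xs) = (\<lambda>(i, j). {f i, f j}) ` set (cycle_pairs xs)"
proof -
  obtain x ys where xs: "xs = x # ys" using assms by (cases xs) auto
  have "(\<lambda>(i, j). {f i, f j}) ((\<lambda>(i, j). (min i j, max i j)) p) = (\<lambda>(i, j). {f i, f j}) p" for p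
    by (auto simp: min_def max_def split: prod.split)
  hence "(\<lambda>(i, j). {f i, f j}) ` set (cycle_pairs xs) =
      (\<lambda>(i, j). {f i, f j}) ` set (zip xs (tl xs @ [hd xs]))"
    unfolding cycle_pairs_def set_map image_image by simp
  also have "\<dots> = insert {f (last xs), f (hd xs)} (path_edges (map f xs))"
    unfolding xs using path_edges_map_zip[of f x ys x] by simp
  finally show ?thesis using assms by (simp add: cycle_edges_def last_map hd_map)
qed

text \<open>Reading indices as entries of \<open>L\<close> is injective on increasing pairs, hence
  on sets of them, so distinct index cycles become distinct cycles of \<open>G\<close>. A subgraph
  suffices, as more edges only add cycles.\<close>

lemma not_4_cactus_if_five_cycles:
  assumes k: "k_cactus 4 G" and L: "distinct L" "length L = n" and sub: "edges_of L ps \<subseteq> edges G"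
    and five: "five_cycles n ps e xss"
  shows False
proof -
  let ?h = "\<lambda>(i, j). {L ! i, L ! j}"
  let ?Cs = "(\<lambda>xs. cycle_edges (map (nth L) xs)) ` set xss"
  have f: "length xss = 5" "distinct (map (\<lambda>xs. set (cycle_pairs xs)) xss)" "e \<in> set ps"
    "set ps \<subseteq> set (pairs (length L))"
    and xs: "\<And>xs. xs \<in> set xss \<Longrightarrow> distinct xs \<and> 3 \<le> length xs \<and> (\<forall>x \<in> set xs. x < length L) \<and>
        e \<in> set (cycle_pairs xs) \<and> set (cycle_pairs xs) \<subseteq> set ps"
    using five unfolding five_cycles_def L(2) by auto
  have ce: "cycle_edges (map (nth L) xs) = ?h ` set (cycle_pairs xs)" if "xs \<in> set xss" for xs
  proof (rule cycle_edges_map)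
    show "xs \<noteq> []" using xs[OF that] by auto
  qed
  have "inj_on (\<lambda>xs. set (cycle_pairs xs)) (set xss)" "distinct xss"
    using f(2) by (auto simp: distinct_map)
  moreover have "inj_on ((`) ?h) (Pow (set (pairs (length L))))"
    using inj_on_edge_of_pair[OF L(1)] by (rule inj_on_image_Pow)
  hence "inj_on ((`) ?h) ((\<lambda>xs. set (cycle_pairs xs)) ` set xss)"
    by (rule inj_on_subset) (use f(4) xs in blast)
  ultimately have "inj_on ((`) ?h \<circ> (\<lambda>xs. set (cycle_pairs xs))) (set xss)"
    by (intro comp_inj_on)
  hence "inj_on (\<lambda>xs. cycle_edges (map (nth L) xs)) (set xss)"
    using ce by (simp cong: inj_on_cong)
  hence c5: "card ?Cs = 5" using f(1) \<open>distinct xss\<close> by (simp add: card_image distinct_card)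
  have sub5: "?Cs \<subseteq> {C. is_cycle G C \<and> ?h e \<in> C}"
  proof -
    have "is_cycle G (cycle_edges (map (nth L) xs)) \<and> ?h e \<in> cycle_edges (map (nth L) xs)"
      if "xs \<in> set xss" for xs
    proof -
      have "distinct (map (nth L) xs)"
        using xs[OF that] L(1) by (auto simp: distinct_map inj_on_def nth_eq_iff_index_eq)
      moreover have "cycle_edges (map (nth L) xs) \<subseteq> edges G"
        unfolding ce[OF that] using xs[OF that] sub unfolding edges_of_def by blast
      moreover have "?h e \<in> cycle_edges (map (nth L) xs)"
        unfolding ce[OF that] using xs[OF that] by blast
      ultimately show ?thesis
        unfolding is_cycle_alt using xs[OF that] by (auto intro!: exI[of _ "map (nth L) xs"])
    qed
    thus ?thesis by blast
  qed
  have "finite_simple_graph G" using k unfolding k_cactus_def by blast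
  from card_mono[OF finite_cycles[OF this] sub5]
  have "5 \<le> card {C. is_cycle G C \<and> ?h e \<in> C}" unfolding c5 .
  moreover have "?h e \<in> edges G" using f(3) sub unfolding edges_of_def by blast
  hence "card {C. is_cycle G C \<and> ?h e \<in> C} \<le> 4" using k unfolding k_cactus_def by blast
  ultimately show False by linarith
qed

text \<open>The first premise checks the rows; the second checks that the rows and the exceptions
  \<open>X\<close> exhaust all places where the new vertex can be attached.\<close>

lemma five_cycles_table:
  assumes "list_all (\<lambda>(p, e, xss). five_cycles 6 (ps @ [(fst p, 5), (snd p, 5)]) e xss) tab"
    "list_all (\<lambda>p. p \<in> set (map fst tab) \<or> p \<in> set X) (pairs 5)"
    "p \<in> set (pairs 5)" "p \<notin> set X"
  obtains e xss where "five_cycles 6 (ps @ [(fst p, 5), (snd p, 5)]) e xss"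
proof -
  have "p \<in> set (map fst tab)" using assms(2-4) unfolding list_all_iff by blast
  then obtain e xss where "(p, e, xss) \<in> set tab" by auto
  thus ?thesis using assms(1) that unfolding list_all_iff by fastforce
qed

text \<open>In the following tables, each row consists of the two neighbours of an added vertex \<open>5\<close>, an
  edge, and five cycles through that edge.\<close>

lemma five_cycles_triangle:
  assumes "p \<in> set (pairs 5)" "p \<noteq> (3, 4)"
  obtains e xss where
    "five_cycles 6 (pairs_without 5 [(0, 1), (1, 2), (0, 2)] @ [(fst p, 5), (snd p, 5)]) e xss"
proof -
  let ?tab = "[
    ((0, 1), (0, 3), [[0, 3, 4], [0, 3, 1, 4], [0, 3, 1, 5], [0, 3, 2, 4], [0, 3, 4, 1, 5]]),
    ((0, 2), (0, 3), [[0, 3, 4], [0, 3, 1, 4], [0, 3, 2, 4], [0, 3, 2, 5], [0, 3, 4, 2, 5]]),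
    ((1, 2), (0, 3), [[0, 3, 4], [0, 3, 1, 4], [0, 3, 2, 4], [0, 3, 1, 5, 2, 4], [0, 3, 2, 5, 1, 4]]),
    ((0, 3), (0, 4), [[0, 3, 4], [0, 3, 1, 4], [0, 3, 2, 4], [0, 4, 3, 5], [0, 4, 1, 3, 5]]),
    ((1, 3), (1, 4), [[1, 3, 4], [0, 3, 1, 4], [1, 3, 2, 4], [1, 4, 3, 5], [0, 3, 5, 1, 4]]),
    ((2, 3), (2, 4), [[2, 3, 4], [0, 3, 2, 4], [1, 3, 2, 4], [2, 4, 3, 5], [0, 3, 5, 2, 4]]),
    ((0, 4), (0, 3), [[0, 3, 4], [0, 3, 1, 4], [0, 3, 2, 4], [0, 3, 4, 5], [0, 3, 1, 4, 5]]),
    ((1, 4), (1, 3), [[1, 3, 4], [0, 3, 1, 4], [1, 3, 2, 4], [1, 3, 4, 5], [0, 3, 1, 5, 4]]),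
    ((2, 4), (2, 3), [[2, 3, 4], [0, 3, 2, 4], [1, 3, 2, 4], [2, 3, 4, 5], [0, 3, 2, 5, 4]])]"
  have "list_all (\<lambda>(p, e, xss). five_cycles 6 (pairs_without 5 [(0, 1), (1, 2), (0, 2)]
      @ [(fst p, 5), (snd p, 5)]) e xss) ?tab"
    by code_simp
  \<comment> \<open>The pair (3, 4) has no row: these are the ends of the theta graph, and attaching
    5 to them yields theta(1,2,2,2,2).\<close>
  moreover have "list_all (\<lambda>p. p \<in> set (map fst ?tab) \<or> p \<in> set [(3, 4)]) (pairs 5)"
    by code_simp
  ultimately show ?thesis
    by (rule five_cycles_table[OF _ _ assms(1)]) (use assms that in auto)
qed

lemma five_cycles_star:
  assumes "p \<in> set (pairs 5)" "p \<noteq> (1, 4)"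
  obtains e xss where
    "five_cycles 6 (pairs_without 5 [(0, 1), (1, 2), (1, 3)] @ [(fst p, 5), (snd p, 5)]) e xss"
proof -
  let ?tab = "[
    ((0, 1), (0, 2), [[0, 2, 3], [0, 2, 4], [0, 2, 3, 4], [0, 2, 4, 3], [0, 2, 4, 1, 5]]),
    ((0, 2), (0, 2), [[0, 2, 3], [0, 2, 4], [0, 2, 5], [0, 2, 3, 4], [0, 2, 4, 3]]),
    ((1, 2), (0, 2), [[0, 2, 3], [0, 2, 4], [0, 2, 3, 4], [0, 2, 4, 3], [0, 2, 5, 1, 4]]),
    ((0, 3), (0, 2), [[0, 2, 3], [0, 2, 4], [0, 2, 3, 4], [0, 2, 3, 5], [0, 2, 4, 3]]),
    ((1, 3), (0, 2), [[0, 2, 3], [0, 2, 4], [0, 2, 3, 4], [0, 2, 4, 3], [0, 2, 3, 5, 1, 4]]),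
    ((2, 3), (0, 2), [[0, 2, 3], [0, 2, 4], [0, 2, 3, 4], [0, 2, 4, 3], [0, 2, 5, 3]]),
    ((0, 4), (0, 2), [[0, 2, 3], [0, 2, 4], [0, 2, 3, 4], [0, 2, 4, 3], [0, 2, 4, 5]]),
    ((2, 4), (0, 2), [[0, 2, 3], [0, 2, 4], [0, 2, 3, 4], [0, 2, 4, 3], [0, 2, 5, 4]]),
    ((3, 4), (0, 2), [[0, 2, 3], [0, 2, 4], [0, 2, 3, 4], [0, 2, 4, 3], [0, 2, 3, 5, 4]])]"
  have "list_all (\<lambda>(p, e, xss). five_cycles 6 (pairs_without 5 [(0, 1), (1, 2), (1, 3)]
      @ [(fst p, 5), (snd p, 5)]) e xss) ?tab"
    by code_simp
  \<comment> \<open>The graph here is a K_4 with vertex 1 pendant at 4. Attaching 5 to 1 and 4 gives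
    a K_4 and a triangle sharing the cut vertex 4, which is excluded later by
    nonseparability.\<close>
  moreover have "list_all (\<lambda>p. p \<in> set (map fst ?tab) \<or> p \<in> set [(1, 4)]) (pairs 5)"
    by code_simp
  ultimately show ?thesis
    by (rule five_cycles_table[OF _ _ assms(1)]) (use assms that in auto)
qed

lemma five_cycles_path:
  assumes "p \<in> set (pairs 5)"
  obtains e xss where
    "five_cycles 6 (pairs_without 5 [(0, 1), (1, 2), (2, 3)] @ [(fst p, 5), (snd p, 5)]) e xss"
proof -
  let ?tab = "[
    ((0, 1), (0, 2), [[0, 2, 4], [0, 2, 4, 3], [0, 2, 4, 1, 3], [0, 2, 4, 1, 5], [0, 2, 4, 3, 1, 5]]),
    ((0, 2), (0, 3), [[0, 3, 4], [0, 2, 4, 3], [0, 3, 1, 4], [0, 2, 4, 1, 3], [0, 3, 4, 2, 5]]),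
    ((1, 2), (0, 2), [[0, 2, 4], [0, 2, 4, 3], [0, 2, 4, 1, 3], [0, 2, 5, 1, 3], [0, 2, 5, 1, 4]]),
    ((0, 3), (0, 2), [[0, 2, 4], [0, 2, 4, 3], [0, 2, 4, 1, 3], [0, 2, 4, 3, 5], [0, 2, 4, 1, 3, 5]]),
    ((1, 3), (0, 3), [[0, 3, 4], [0, 2, 4, 3], [0, 3, 1, 4], [0, 2, 4, 1, 3], [0, 3, 5, 1, 4]]),
    ((2, 3), (0, 2), [[0, 2, 4], [0, 2, 4, 3], [0, 2, 5, 3], [0, 2, 4, 1, 3], [0, 2, 5, 3, 4]]),
    ((0, 4), (0, 3), [[0, 3, 4], [0, 2, 4, 3], [0, 3, 1, 4], [0, 3, 4, 5], [0, 2, 4, 1, 3]]),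
    ((1, 4), (0, 3), [[0, 3, 4], [0, 2, 4, 3], [0, 3, 1, 4], [0, 2, 4, 1, 3], [0, 3, 1, 5, 4]]),
    ((2, 4), (0, 2), [[0, 2, 4], [0, 2, 4, 3], [0, 2, 5, 4], [0, 2, 4, 1, 3], [0, 2, 5, 4, 3]]),
    ((3, 4), (0, 3), [[0, 3, 4], [0, 2, 4, 3], [0, 3, 1, 4], [0, 3, 5, 4], [0, 2, 4, 1, 3]])]"
  have "list_all (\<lambda>(p, e, xss). five_cycles 6 (pairs_without 5 [(0, 1), (1, 2), (2, 3)]
      @ [(fst p, 5), (snd p, 5)]) e xss) ?tab"
    by code_simp
  moreover have "list_all (\<lambda>p. p \<in> set (map fst ?tab) \<or> p \<in> set []) (pairs 5)"
    by code_simp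
  ultimately show ?thesis
    by (rule five_cycles_table[OF _ _ assms(1)]) (use assms that in auto)
qed

lemma five_cycles_path_edge:
  assumes "p \<in> set (pairs 5)"
  obtains e xss where
    "five_cycles 6 (pairs_without 5 [(0, 1), (1, 2), (3, 4)] @ [(fst p, 5), (snd p, 5)]) e xss"
proof -
  let ?tab = "[
    ((0, 1), (0, 2), [[0, 2, 3], [0, 2, 4], [0, 2, 3, 1, 4], [0, 2, 3, 1, 5], [0, 2, 4, 1, 3]]),
    ((0, 2), (0, 2), [[0, 2, 3], [0, 2, 4], [0, 2, 5], [0, 2, 3, 1, 4], [0, 2, 4, 1, 3]]),
    ((1, 2), (0, 2), [[0, 2, 3], [0, 2, 4], [0, 2, 3, 1, 4], [0, 2, 4, 1, 3], [0, 2, 5, 1, 3]]),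
    ((0, 3), (0, 2), [[0, 2, 3], [0, 2, 4], [0, 2, 3, 5], [0, 2, 3, 1, 4], [0, 2, 4, 1, 3]]),
    ((1, 3), (0, 2), [[0, 2, 3], [0, 2, 4], [0, 2, 3, 1, 4], [0, 2, 4, 1, 3], [0, 2, 3, 5, 1, 4]]),
    ((2, 3), (0, 2), [[0, 2, 3], [0, 2, 4], [0, 2, 5, 3], [0, 2, 3, 1, 4], [0, 2, 4, 1, 3]]),
    ((0, 4), (0, 2), [[0, 2, 3], [0, 2, 4], [0, 2, 4, 5], [0, 2, 3, 1, 4], [0, 2, 4, 1, 3]]),
    ((1, 4), (0, 2), [[0, 2, 3], [0, 2, 4], [0, 2, 3, 1, 4], [0, 2, 4, 1, 3], [0, 2, 3, 1, 5, 4]]),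
    ((2, 4), (0, 2), [[0, 2, 3], [0, 2, 4], [0, 2, 5, 4], [0, 2, 3, 1, 4], [0, 2, 4, 1, 3]]),
    ((3, 4), (0, 2), [[0, 2, 3], [0, 2, 4], [0, 2, 3, 1, 4], [0, 2, 3, 5, 4], [0, 2, 4, 1, 3]])]"
  have "list_all (\<lambda>(p, e, xss). five_cycles 6 (pairs_without 5 [(0, 1), (1, 2), (3, 4)]
      @ [(fst p, 5), (snd p, 5)]) e xss) ?tab"
    by code_simp
  moreover have "list_all (\<lambda>p. p \<in> set (map fst ?tab) \<or> p \<in> set []) (pairs 5)"
    by code_simp
  ultimately show ?thesis
    by (rule five_cycles_table[OF _ _ assms(1)]) (use assms that in auto)
qed

section \<open>Blocks with at most six vertices\<close>

lemma simple_edgeE: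
  assumes "finite_simple_graph G" "e \<in> edges G"
  obtains u v where "e = {u, v}" "u \<in> verts G" "v \<in> verts G" "u \<noteq> v"
proof -
  have "e \<in> all_edges (verts G)" using assms unfolding finite_simple_graph_def by (elim conjE) (rule subsetD)
  thus ?thesis using that unfolding all_edges_def by (elim CollectE exE conjE)
qed

text \<open>On five vertices there are ten possible edges; graphs with eight or seven of them are
  easier to classify by the two or three missing ones.\<close>

lemma edges_eq_diff:
  assumes "finite V" "E \<subseteq> all_edges V"
  obtains D where "D \<subseteq> all_edges V" "E = all_edges V - D" "card D + card E = card V choose 2"
proof (rule that[of "all_edges V - E"])
  show "E = all_edges V - (all_edges V - E)" using assms(2) by (simp add: double_diff)
  have fin: "finite E" using assms finite_all_edges by (meson finite_subset)
  show "card (all_edges V - E) + card E = card V choose 2"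
    unfolding card_all_edges[OF assms(1), symmetric]
    using card_Diff_subset[OF fin assms(2)] card_mono[OF finite_all_edges[OF assms(1)] assms(2)] by linarith
qed simp

lemma five_setE:
  assumes "card V = 5" "{a, b, c} \<subseteq> V" "distinct [a, b, c]"
  obtains d g where "distinct [a, b, c, d, g]" "V = set [a, b, c, d, g]"
proof -
  have "finite V" using assms(1) by (metis card.infinite zero_neq_numeral)
  have "card {a, b, c} = 3" using assms(3) by simp
  hence "card (V - {a, b, c}) = 2"
    using card_Diff_subset[of "{a, b, c}" V] assms by simp
  then obtain d g where dg: "V - {a, b, c} = {d, g}" "d \<noteq> g" unfolding card_2_iff by blast
  have "V = {a, b, c} \<union> (V - {a, b, c})" using assms(2) by blast
  hence V: "V = set [a, b, c, d, g]" unfolding dg(1) by auto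
  have "d \<notin> {a, b, c}" "g \<notin> {a, b, c}" using dg(1) by blast+
  hence "distinct [a, b, c, d, g]" using assms(3) dg(2) by auto
  thus ?thesis using V that by blast
qed

lemma two_edges_cases:
  assumes "card V = 5" "D \<subseteq> all_edges V" "card D = 2"
  obtains L ds where "distinct L" "V = set L" "length L = 5" "D = edges_of L ds"
    "ds \<in> {[(0, 1), (1, 2)], [(0, 1), (2, 3)]}"
proof -
  note result = that
  obtain e f where D: "D = {e, f}" "e \<noteq> f" using assms(3) unfolding card_2_iff by blast
  obtain a b where e: "e = {a, b}" "a \<in> V" "b \<in> V" "a \<noteq> b"
    using assms(2) D unfolding all_edges_def by blast
  obtain c d where f: "f = {c, d}" "c \<in> V" "d \<in> V" "c \<noteq> d"
    using assms(2) D unfolding all_edges_def by blast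
  have adj: thesis if xyz: "D = {{x, y}, {y, z}}" "distinct [x, y, z]" "{x, y, z} \<subseteq> V" for x y z
  proof -
    obtain d g where "distinct [x, y, z, d, g]" "V = set [x, y, z, d, g]"
      using five_setE[OF assms(1) xyz(3,2)] .
    thus ?thesis using xyz(1) by (intro result[of "[x, y, z, d, g]" "[(0, 1), (1, 2)]"])
      (auto simp: edges_of_def)
  qed
  consider "c = a" | "c = b" | "d = a" | "d = b" | "distinct [a, b, c, d]" using e f by auto
  thus ?thesis
  proof cases
    case 1
    show ?thesis by (rule adj[of b a d]) (use 1 e f D in \<open>auto simp: insert_commute\<close>)
  next
    case 2
    show ?thesis by (rule adj[of a b d]) (use 2 e f D in \<open>auto simp: insert_commute\<close>)
  next
    case 3
    show ?thesis by (rule adj[of b a c]) (use 3 e f D in \<open>auto simp: insert_commute\<close>)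
  next
    case 4
    show ?thesis by (rule adj[of a b c]) (use 4 e f D in \<open>auto simp: insert_commute\<close>)
  next
    case 5
    hence "distinct [a, b, c]" "{a, b, c} \<subseteq> V" using e f by auto
    then obtain x y where xy: "distinct [a, b, c, x, y]" "V = set [a, b, c, x, y]"
      using five_setE[OF assms(1)] by blast
    have "d = x \<or> d = y" using 5 f(3) xy(2) by auto
    hence "\<exists>g. distinct [a, b, c, d, g] \<and> V = set [a, b, c, d, g]"
    proof
      assume "d = x"
      thus ?thesis using xy by blast
    next
      assume "d = y"
      thus ?thesis using xy by (intro exI[of _ x]) auto
    qed
    then obtain g where g: "distinct [a, b, c, d, g]" "V = set [a, b, c, d, g]" by blast
    show ?thesis
      using g D(1) e(1) f(1) by (intro result[of "[a, b, c, d, g]" "[(0, 1), (2, 3)]"])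
        (auto simp: edges_of_def)
  qed
qed

text \<open>Three pairwise disjoint edges would need six vertices, so two of them meet; what remains
  is the position of the third edge relative to this path.\<close>

lemma three_edges_cases:
  assumes "card V = 5" "D \<subseteq> all_edges V" "card D = 3"
  obtains L ds where "distinct L" "V = set L" "length L = 5" "D = edges_of L ds"
    "ds \<in> {[(0, 1), (1, 2), (0, 2)], [(0, 1), (1, 2), (1, 3)], [(0, 1), (1, 2), (2, 3)], [(0, 1), (1, 2), (3, 4)]}"
proof -
  have "finite V" using assms(1) by (metis card.infinite zero_neq_numeral)
  have "\<exists>e \<in> D. \<exists>f \<in> D. e \<noteq> f \<and> e \<inter> f \<noteq> {}"
  proof (rule ccontr)
    assume "\<not> ?thesis"
    hence dj: "pairwise disjnt D" unfolding pairwise_def disjnt_def by blast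
    have two: "card e = 2" "finite e" "e \<subseteq> V" if "e \<in> D" for e
      using that assms(2) unfolding all_edges_def by auto
    have "card (\<Union>D) = sum card D" using dj two by (intro card_Union_disjoint) auto
    also have "\<dots> = 6" using two assms(3) by simp
    finally have "card (\<Union>D) = 6" .
    moreover have "card (\<Union>D) \<le> card V" using two \<open>finite V\<close> by (intro card_mono) auto
    ultimately show False using assms(1) by simp
  qed
  then obtain e f where ef: "e \<in> D" "f \<in> D" "e \<noteq> f" "e \<inter> f \<noteq> {}" by blast
  then obtain b where b: "b \<in> e" "b \<in> f" by blast
  obtain a where a: "e = {a, b}" "a \<in> V" "b \<in> V" "a \<noteq> b"
    using subsetD[OF assms(2) ef(1)] b(1) unfolding all_edges_def by blast
  obtain c where c: "f = {b, c}" "c \<in> V" "c \<noteq> b"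
    using subsetD[OF assms(2) ef(2)] b(2) unfolding all_edges_def by blast
  have "distinct [a, b, c]" "{a, b, c} \<subseteq> V" using a c ef(3) by auto
  then obtain d g where L: "distinct [a, b, c, d, g]" and V: "V = set [a, b, c, d, g]"
    using five_setE[OF assms(1)] by blast
  have "finite D" using assms(3) by (metis card.infinite zero_neq_numeral)
  hence "card (D - {e, f}) = 1" using ef assms(3) by (simp add: card_Diff_subset)
  then obtain h where h: "D - {e, f} = {h}" by (auto simp: card_1_singleton_iff)
  have "D = {e, f, h}" using ef(1,2) h by blast
  hence D: "D = {{a, b}, {b, c}, h}" using a(1) c(1) by simp
  have "h \<in> D" "h \<noteq> e" "h \<noteq> f" using h by blast+
  hence hV: "h \<in> all_edges V" "h \<noteq> {a, b}" "h \<noteq> {b, c}" using assms(2) a(1) c(1) by auto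
  \<comment> \<open>These are the ten pairs of vertices without {a, b} and {b, c}.\<close>
  have "h = {a, c} \<or> h = {b, d} \<or> h = {b, g} \<or> h = {c, d} \<or> h = {c, g} \<or> h = {a, d} \<or> h = {a, g} \<or> h = {d, g}"
  proof -
    obtain x y where xy: "h = {x, y}" "x \<in> V" "y \<in> V" "x \<noteq> y" using hV(1) unfolding all_edges_def by blast
    have "x = a \<or> x = b \<or> x = c \<or> x = d \<or> x = g" "y = a \<or> y = b \<or> y = c \<or> y = d \<or> y = g"
      using xy V by auto
    thus ?thesis using xy(1,4) hV(2,3) by (elim disjE) (simp_all add: insert_commute)
  qed
  thus ?thesis
  proof (elim disjE)
    assume "h = {a, c}"
    thus ?thesis using L V D by (intro that[of "[a, b, c, d, g]" "[(0, 1), (1, 2), (0, 2)]"])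
      (auto simp: edges_of_def)
  next
    assume "h = {b, d}"
    thus ?thesis using L V D by (intro that[of "[a, b, c, d, g]" "[(0, 1), (1, 2), (1, 3)]"])
      (auto simp: edges_of_def)
  next
    assume "h = {b, g}"
    thus ?thesis using L V D by (intro that[of "[a, b, c, g, d]" "[(0, 1), (1, 2), (1, 3)]"])
      (auto simp: edges_of_def)
  next
    assume "h = {c, d}"
    thus ?thesis using L V D by (intro that[of "[a, b, c, d, g]" "[(0, 1), (1, 2), (2, 3)]"])
      (auto simp: edges_of_def)
  next
    assume "h = {c, g}"
    thus ?thesis using L V D by (intro that[of "[a, b, c, g, d]" "[(0, 1), (1, 2), (2, 3)]"])
      (auto simp: edges_of_def)
  next
    assume "h = {a, d}"
    thus ?thesis using L V D by (intro that[of "[c, b, a, d, g]" "[(0, 1), (1, 2), (2, 3)]"])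
      (auto simp: edges_of_def insert_commute)
  next
    assume "h = {a, g}"
    thus ?thesis using L V D by (intro that[of "[c, b, a, g, d]" "[(0, 1), (1, 2), (2, 3)]"])
      (auto simp: edges_of_def insert_commute)
  next
    assume "h = {d, g}"
    thus ?thesis using L V D by (intro that[of "[a, b, c, d, g]" "[(0, 1), (1, 2), (3, 4)]"])
      (auto simp: edges_of_def)
  qed
qed

section \<open>Isomorphisms to the named graphs\<close>

lemma graph_iso_edges_of:
  assumes "distinct L" "verts G = set L" "edges G = edges_of L ps"
    and H: "verts H = {0..<length L}" "edges H = edges_of [0..<length L] ps"
    and ps: "set ps \<subseteq> set (pairs (length L))"
  shows "graph_iso H G"
proof (rule graph_isoI)
  show "bij_betw (nth L) (verts H) (verts G)"
    unfolding assms(2) H(1) using assms(1) bij_betw_nth[of L "{0..<length L}" "set L"]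
    by (simp add: atLeast0LessThan)
  have "nth L ` {[0..<length L] ! i, [0..<length L] ! j} = {L ! i, L ! j}" if "(i, j) \<in> set ps" for i j
    using subsetD[OF ps that] by (auto simp: set_pairs)
  thus "edges G = (\<lambda>e. nth L ` e) ` edges H"
    unfolding assms(3) H(2) edges_of_def image_image by (intro image_cong) auto
qed

lemma graph_iso_complete:
  assumes "finite (verts G)" "edges G = all_edges (verts G)" "card (verts G) = n"
  shows "graph_iso (complete_graph n) G"
proof -
  obtain L where L: "distinct L" "verts G = set L" using finite_distinct_list[OF assms(1)] by metis
  hence len: "length L = n" using assms(3) distinct_card by metis
  show ?thesis
    using all_edges_eq_edges_of[OF L(1)] all_edges_eq_edges_of[of "[0..<n]"] len L assms(2)
    by (intro graph_iso_edges_of[of L G "pairs n"]) (simp_all add: complete_graph_def)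
qed

lemma theta_1222: "theta [1, 2, 2, 2] =
    ({0..<5}, edges_of [0..<5] [(0, 1), (0, 2), (1, 2), (0, 3), (1, 3), (0, 4), (1, 4)])"
proof -
  have "{..<length [1, 2, 2, 2 :: nat]} = {0, 1, 2, 3}" by auto
  hence "theta [1, 2, 2, 2] =
    ({0, 1, 2, 3, 4}, {{0, 1}, {0, 2}, {2, 1}, {0, 3}, {3, 1}, {0, 4}, {4, 1}})"
    unfolding theta_def by (simp add: theta_path_def Let_def numeral_eq_Suc lessThan_Suc insert_commute)
  moreover have "{0..<5 :: nat} = {0, 1, 2, 3, 4}" by auto
  moreover have "[0..<5] = [0, 1, 2, 3, 4]" by code_simp
  ultimately show ?thesis by (simp only:) (simp add: edges_of_def insert_commute)
qed

lemma theta_12222: "theta [1, 2, 2, 2, 2] =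
    ({0..<6}, edges_of [0..<6] [(0, 1), (0, 2), (1, 2), (0, 3), (1, 3), (0, 4), (1, 4), (0, 5), (1, 5)])"
proof -
  have "{..<length [1, 2, 2, 2, 2 :: nat]} = {0, 1, 2, 3, 4}" by auto
  hence "theta [1, 2, 2, 2, 2] =
    ({0, 1, 2, 3, 4, 5}, {{0, 1}, {0, 2}, {2, 1}, {0, 3}, {3, 1}, {0, 4}, {4, 1}, {0, 5}, {5, 1}})"
    unfolding theta_def by (simp add: theta_path_def Let_def numeral_eq_Suc lessThan_Suc insert_commute)
  moreover have "{0..<6 :: nat} = {0, 1, 2, 3, 4, 5}" by auto
  moreover have "[0..<6] = [0, 1, 2, 3, 4, 5]" by code_simp
  ultimately show ?thesis by (simp only:) (simp add: edges_of_def insert_commute)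
qed

lemma theta_tilde_edges_of:
  "theta_tilde1 = ({0..<5}, edges_of [0..<5] (pairs_without 5 [(0, 1), (1, 2), (2, 3)]))"
  "theta_tilde2 = ({0..<5}, edges_of [0..<5] (pairs_without 5 [(0, 1), (1, 2), (3, 4)]))"
proof -
  have diff: "all_edges {0..<5} - edges_of [0..<5] ds = edges_of [0..<5] (pairs_without 5 ds)"
    if "set ds \<subseteq> set (pairs 5)" for ds
    using all_edges_diff[of "[0..<5]" ds] that by simp
  have upt: "[0..<5] = [0, 1, 2, 3, 4]" by code_simp
  have "{{0, 1}, {1, 2}, {2, 3}} = edges_of [0..<5] [(0, 1), (1, 2), (2, 3)]"
    "{{0, 1}, {1, 2}, {3, 4}} = edges_of [0..<5] [(0, 1), (1, 2), (3, 4)]"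
    unfolding upt by (simp_all add: edges_of_def)
  moreover have "set [(0, 1), (1, 2), (2, 3)] \<subseteq> set (pairs 5)" "set [(0, 1), (1, 2), (3, 4)] \<subseteq> set (pairs 5)"
    by (simp_all add: set_pairs)
  ultimately show "theta_tilde1 = ({0..<5}, edges_of [0..<5] (pairs_without 5 [(0, 1), (1, 2), (2, 3)]))"
    "theta_tilde2 = ({0..<5}, edges_of [0..<5] (pairs_without 5 [(0, 1), (1, 2), (3, 4)]))"
    unfolding theta_tilde1_def theta_tilde2_def complement_graph_def fst_conv snd_conv
    by (simp_all only: diff)
qed

section \<open>Neighbourhoods and degrees\<close>

definition nbrs :: "'a ugraph \<Rightarrow> 'a \<Rightarrow> 'a set" where
  "nbrs G v = {x. {v, x} \<in> edges G}"

lemma nbrs_subset: "finite_simple_graph G \<Longrightarrow> nbrs G v \<subseteq> verts G - {v}"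
proof
  fix x assume s: "finite_simple_graph G" and "x \<in> nbrs G v"
  hence "{v, x} \<in> edges G" by (simp add: nbrs_def)
  with s obtain a b where "{v, x} = {a, b}" "a \<in> verts G" "b \<in> verts G" "a \<noteq> b" by (rule simple_edgeE)
  thus "x \<in> verts G - {v}" by (auto simp: doubleton_eq_iff)
qed

lemma nbrs_sym: "x \<in> nbrs G v \<longleftrightarrow> v \<in> nbrs G x"
  by (simp add: nbrs_def insert_commute)

lemma incident_edges:
  assumes "finite_simple_graph G"
  shows "{e \<in> edges G. v \<in> e} = (\<lambda>x. {v, x}) ` nbrs G v"
proof (intro equalityI subsetI)
  fix e assume "e \<in> {e \<in> edges G. v \<in> e}"
  hence e: "e \<in> edges G" "v \<in> e" by auto
  obtain a b where "e = {a, b}" using simple_edgeE[OF assms e(1)] by metis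
  hence "e = {v, a} \<or> e = {v, b}" using e(2) by auto
  thus "e \<in> (\<lambda>x. {v, x}) ` nbrs G v" using e(1) unfolding nbrs_def by blast
qed (auto simp: nbrs_def)

lemma card_incident_edges:
  assumes "finite_simple_graph G"
  shows "card {e \<in> edges G. v \<in> e} = card (nbrs G v)"
  unfolding incident_edges[OF assms]
  by (rule card_image) (auto simp: inj_on_def doubleton_eq_iff)

text \<open>The handshake identity, by double counting incidences of vertices and edges.\<close>

lemma sum_card_nbrs:
  assumes "finite_simple_graph G"
  shows "(\<Sum>v \<in> verts G. card (nbrs G v)) = 2 * card (edges G)"
proof -
  have "card {v \<in> verts G. v \<in> e} = 2" if "e \<in> edges G" for e
  proof -
    obtain a b where "e = {a, b}" "a \<in> verts G" "b \<in> verts G" "a \<noteq> b"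
      using assms \<open>e \<in> edges G\<close> by (rule simple_edgeE)
    moreover from this have "{v \<in> verts G. v \<in> e} = {a, b}" by auto
    ultimately show ?thesis by simp
  qed
  moreover have "finite (verts G)" using assms unfolding finite_simple_graph_def by simp
  ultimately have "(\<Sum>v \<in> verts G. card {e \<in> edges G. v \<in> e}) = 2 * card (edges G)"
    using finite_edges[OF assms] by (intro sum_multicount) auto
  thus ?thesis by (simp add: card_incident_edges[OF assms])
qed

text \<open>An isolated vertex contradicts connectedness, and the only neighbour of a vertex of
  degree one is a cut vertex once a third vertex exists.\<close>

lemma nonseparable_card_nbrs_ge:
  assumes simple: "finite_simple_graph G" and con: "connected_graph G" and ns: "nonseparable G"
    and n: "3 \<le> card (verts G)" and v: "v \<in> verts G"
  shows "2 \<le> card (nbrs G v)"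
proof (rule ccontr)
  assume "\<not> 2 \<le> card (nbrs G v)"
  moreover have fin: "finite (verts G)" using simple unfolding finite_simple_graph_def by simp
  hence finN: "finite (nbrs G v)" using nbrs_subset[OF simple] by (meson finite_Diff finite_subset)
  ultimately consider "nbrs G v = {}" | x where "nbrs G v = {x}"
    by (metis One_nat_def card_0_eq card_1_singletonE less_2_cases not_le)
  thus False
  proof cases
    case 1
    have "verts G \<noteq> {v}" using n by auto
    then obtain t where t: "t \<in> verts G" "t \<noteq> v" using v by blast
    have "(v, t) \<in> {(x, y). {x, y} \<in> edges G}\<^sup>*" using con v t unfolding connected_graph_def by blast
    thus False
    proof (cases rule: converse_rtranclE)
      case base
      thus False using t(2) by simp
    next
      case (step y)
      thus False using 1 unfolding nbrs_def by blast
    qed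
  next
    case 2
    have x: "x \<in> verts G" "x \<noteq> v" using nbrs_subset[OF simple, of v] 2 by auto
    have "split_at G x {v, x} (verts G - {v})"
      unfolding split_at_def
    proof (intro conjI ballI)
      fix e assume e: "e \<in> edges G"
      show "e \<subseteq> {v, x} \<or> e \<subseteq> verts G - {v}"
      proof (cases "v \<in> e")
        case True
        hence "e \<in> {e \<in> edges G. v \<in> e}" using e by simp
        hence "e = {v, x}" unfolding incident_edges[OF simple] 2 by simp
        thus ?thesis by simp
      next
        case False
        obtain a b where "e = {a, b}" "a \<in> verts G" "b \<in> verts G"
          using simple_edgeE[OF simple e] by metis
        thus ?thesis using False by auto
      qed
    qed (use x v in auto)
    moreover have "2 \<le> card {v, x}" "2 \<le> card (verts G - {v})" using x n v fin by simp_all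
    ultimately show False using ns unfolding nonseparable_def by blast
  qed
qed

lemma edges_of_complement:
  assumes "distinct L" "length L = n" "set ds \<subseteq> set (pairs n)"
    "E = all_edges (set L) - edges_of L ds"
  shows "E = edges_of L (pairs_without n ds)"
  using all_edges_diff[OF assms(1)] assms by simp

lemma list_of_length_5E:
  assumes "length L = 5"
  obtains a b c d g where "L = [a, b, c, d, g]"
  using assms by (auto simp: numeral_eq_Suc length_Suc_conv)

lemma pairs_without_triangle:
  "pairs_without 5 [(0, 1), (1, 2), (0, 2)] = [(0, 3), (1, 3), (2, 3), (0, 4), (1, 4), (2, 4), (3, 4)]"
  by code_simp

lemma pairs_without_star:
  "pairs_without 5 [(0, 1), (1, 2), (1, 3)] = [(0, 2), (0, 3), (2, 3), (0, 4), (1, 4), (2, 4), (3, 4)]"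
  by code_simp

lemma graph_iso_theta_1222:
  assumes "distinct L" "length L = 5" "verts G = set L"
    "edges G = edges_of L (pairs_without 5 [(0, 1), (1, 2), (0, 2)])"
  shows "graph_iso (theta [1, 2, 2, 2]) G"
proof -
  obtain a b c d g where L: "L = [a, b, c, d, g]" using assms(2) by (rule list_of_length_5E)
  show ?thesis
  proof (rule graph_iso_edges_of[of "[d, g, a, b, c]"])
    show "edges G = edges_of [d, g, a, b, c] [(0, 1), (0, 2), (1, 2), (0, 3), (1, 3), (0, 4), (1, 4)]"
      unfolding assms(4) pairs_without_triangle L by (simp add: edges_of_def insert_commute)
    show "set [(0, 1), (0, 2), (1, 2), (0, 3), (1, 3), (0, 4), (1, 4)]
        \<subseteq> set (pairs (length [d, g, a, b, c]))"
      by (simp add: set_pairs)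
    have len: "length [d, g, a, b, c] = 5" by simp
    show "verts (theta [1, 2, 2, 2]) = {0..<length [d, g, a, b, c]}" by (simp only: theta_1222 fst_conv len)
    show "edges (theta [1, 2, 2, 2]) = edges_of [0..<length [d, g, a, b, c]]
        [(0, 1), (0, 2), (1, 2), (0, 3), (1, 3), (0, 4), (1, 4)]"
      by (simp only: theta_1222 snd_conv len)
  qed (use assms(1,3) L in auto)
qed

lemma graph_iso_theta_12222:
  assumes "distinct (L @ [w])" "length L = 5" "verts G = set (L @ [w])"
    "edges G = edges_of (L @ [w]) (pairs_without 5 [(0, 1), (1, 2), (0, 2)] @ [(3, 5), (4, 5)])"
  shows "graph_iso (theta [1, 2, 2, 2, 2]) G"
proof -
  obtain a b c d g where L: "L = [a, b, c, d, g]" using assms(2) by (rule list_of_length_5E)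
  show ?thesis
  proof (rule graph_iso_edges_of[of "[d, g, a, b, c, w]"])
    show "edges G = edges_of [d, g, a, b, c, w]
        [(0, 1), (0, 2), (1, 2), (0, 3), (1, 3), (0, 4), (1, 4), (0, 5), (1, 5)]"
      unfolding assms(4) pairs_without_triangle L by (simp add: edges_of_def insert_commute)
    show "set [(0, 1), (0, 2), (1, 2), (0, 3), (1, 3), (0, 4), (1, 4), (0, 5), (1, 5)]
        \<subseteq> set (pairs (length [d, g, a, b, c, w]))"
      by (simp add: set_pairs)
    have len: "length [d, g, a, b, c, w] = 6" by simp
    show "verts (theta [1, 2, 2, 2, 2]) = {0..<length [d, g, a, b, c, w]}" by (simp only: theta_12222 fst_conv len)
    show "edges (theta [1, 2, 2, 2, 2]) = edges_of [0..<length [d, g, a, b, c, w]]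
        [(0, 1), (0, 2), (1, 2), (0, 3), (1, 3), (0, 4), (1, 4), (0, 5), (1, 5)]"
      by (simp only: theta_12222 snd_conv len)
  qed (use assms(1,3) L in auto)
qed

section \<open>Blocks with five and six vertices\<close>

lemma block_5_vertices_8_edges:
  assumes k: "k_cactus 4 G" and n: "card (verts G) = 5" and e: "card (edges G) = 8"
  shows False
proof -
  have s: "finite (verts G)" "edges G \<subseteq> all_edges (verts G)"
    using k unfolding k_cactus_def finite_simple_graph_def by auto
  from s obtain D where D: "D \<subseteq> all_edges (verts G)" "edges G = all_edges (verts G) - D"
      "card D + card (edges G) = card (verts G) choose 2"
    by (rule edges_eq_diff)
  have "card D = 2" using D(3) n e by (simp add: choose_two)
  with n D(1) obtain L ds where L: "distinct L" "verts G = set L" "length L = 5" "D = edges_of L ds"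
      "ds \<in> {[(0, 1), (1, 2)], [(0, 1), (2, 3)]}"
    by (rule two_edges_cases)
  have "set ds \<subseteq> set (pairs 5)" using L(5) by (auto simp: set_pairs)
  hence E: "edges G = edges_of L (pairs_without 5 ds)"
    using D(2) L by (intro edges_of_complement) simp_all
  \<comment> \<open>The ear count gives only four cycles here, so each of the two ways of deleting
    two edges from K_5 needs a certificate.\<close>
  have 1: "five_cycles 5 (pairs_without 5 [(0, 1), (1, 2)]) (0, 2)
      [[0, 2, 3], [0, 2, 4], [0, 2, 3, 4], [0, 2, 4, 3], [0, 2, 3, 1, 4]]"
    by code_simp
  have 2: "five_cycles 5 (pairs_without 5 [(0, 1), (2, 3)]) (0, 2)
      [[0, 2, 4], [0, 2, 1, 3], [0, 2, 1, 4], [0, 2, 4, 3], [0, 2, 1, 3, 4]]"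
    by code_simp
  have "\<exists>e xss. five_cycles 5 (pairs_without 5 ds) e xss" using L(5) 1 2 by blast
  thus False using not_4_cactus_if_five_cycles[OF k L(1,3)] E by blast
qed

text \<open>The missing triangle gives the theta graph, and the missing path and the missing path
  with a separate edge give the other two graphs. A missing star leaves its centre with degree one,
  which nonseparability forbids.\<close>

lemma block_5_vertices_7_edges:
  assumes k: "k_cactus 4 G" and ns: "nonseparable G"
    and n: "card (verts G) = 5" and e: "card (edges G) = 7"
  shows "\<exists>T \<in> {theta [1, 2, 2, 2], theta_tilde1, theta_tilde2}. graph_iso T G"
proof -
  have simple: "finite_simple_graph G" and con: "connected_graph G" using k unfolding k_cactus_def by auto
  hence s: "finite (verts G)" "edges G \<subseteq> all_edges (verts G)"
    unfolding finite_simple_graph_def by auto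
  from s obtain D where D: "D \<subseteq> all_edges (verts G)" "edges G = all_edges (verts G) - D"
      "card D + card (edges G) = card (verts G) choose 2"
    by (rule edges_eq_diff)
  have "card D = 3" using D(3) n e by (simp add: choose_two)
  with n D(1) obtain L ds where L: "distinct L" "verts G = set L" "length L = 5" "D = edges_of L ds"
      and ds: "ds \<in> {[(0, 1), (1, 2), (0, 2)], [(0, 1), (1, 2), (1, 3)], [(0, 1), (1, 2), (2, 3)],
        [(0, 1), (1, 2), (3, 4)]}"
    by (rule three_edges_cases)
  have "set ds \<subseteq> set (pairs 5)" using ds by (auto simp: set_pairs)
  hence E: "edges G = edges_of L (pairs_without 5 ds)"
    using D(2) L by (intro edges_of_complement) simp_all
  have sub: "set (pairs_without 5 ds) \<subseteq> set (pairs (length L))"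
    using L(3) by (auto simp: pairs_without_def)
  consider (tri) "ds = [(0, 1), (1, 2), (0, 2)]" | (star) "ds = [(0, 1), (1, 2), (1, 3)]"
    | (path) "ds = [(0, 1), (1, 2), (2, 3)]" | (p3k2) "ds = [(0, 1), (1, 2), (3, 4)]"
    using ds by blast
  thus ?thesis
  proof cases
    case tri
    thus ?thesis using graph_iso_theta_1222[OF L(1,3,2)] E by simp
  next
    case star
    obtain a b c d g where abc: "L = [a, b, c, d, g]" using L(3) by (rule list_of_length_5E)
    have "edges G = {{a, c}, {a, d}, {c, d}, {a, g}, {b, g}, {c, g}, {d, g}}"
      unfolding E star pairs_without_star abc by (simp add: edges_of_def)
    hence "nbrs G b \<subseteq> {g}" using L(1) abc unfolding nbrs_def by (auto simp: doubleton_eq_iff)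
    hence "card (nbrs G b) \<le> 1" using card_mono[of "{g}" "nbrs G b"] by simp
    moreover have "2 \<le> card (nbrs G b)"
      using L(2) abc n by (intro nonseparable_card_nbrs_ge[OF simple con ns]) simp_all
    ultimately show ?thesis by simp
  next
    case path
    have "graph_iso theta_tilde1 G"
      using L(3) path by (intro graph_iso_edges_of[OF L(1,2) E _ _ sub]) (simp_all add: theta_tilde_edges_of)
    thus ?thesis by simp
  next
    case p3k2
    have "graph_iso theta_tilde2 G"
      using L(3) p3k2 by (intro graph_iso_edges_of[OF L(1,2) E _ _ sub]) (simp_all add: theta_tilde_edges_of)
    thus ?thesis by simp
  qed
qed

text \<open>Deleting \<open>w\<close> leaves seven edges on five vertices, and the tables cover the
  ways of putting \<open>w\<close> back. The rest may be separable, so the missing star has to be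
  treated as well.\<close>

lemma block_6_vertices_degree_2:
  assumes k: "k_cactus 4 G" and ns: "nonseparable G"
    and n: "card (verts G) = 6" and e: "card (edges G) = 9"
    and w: "w \<in> verts G" "card (nbrs G w) = 2"
  shows "graph_iso (theta [1, 2, 2, 2, 2]) G"
proof -
  have simple: "finite_simple_graph G" using k unfolding k_cactus_def by auto
  hence fin: "finite (verts G)" unfolding finite_simple_graph_def by auto
  have finE: "finite (edges G)" using simple by (rule finite_edges)
  let ?V = "verts G - {w}" and ?E = "{e \<in> edges G. w \<notin> e}"
  have split: "edges G = ?E \<union> {e \<in> edges G. w \<in> e}" by blast
  have "card (edges G) = card ?E + card {e \<in> edges G. w \<in> e}"
    by (subst split, rule card_Un_disjoint) (use finE in auto)
  hence e7: "card ?E = 7" using e w(2) card_incident_edges[OF simple, of w] by simp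
  have n5: "card ?V = 5" using n w(1) by simp
  have EV': "?E \<subseteq> all_edges ?V"
  proof
    fix e assume "e \<in> ?E"
    moreover from this obtain a b where "e = {a, b}" "a \<in> verts G" "b \<in> verts G" "a \<noteq> b"
      using simple_edgeE[OF simple, of e] by blast
    ultimately show "e \<in> all_edges ?V" unfolding all_edges_def by blast
  qed
  have "finite ?V" using fin by simp
  from this EV' obtain D where D: "D \<subseteq> all_edges ?V" "?E = all_edges ?V - D" "card D + card ?E = card ?V choose 2"
    by (rule edges_eq_diff)
  have "card D = 3" using D(3) n5 e7 by (simp add: choose_two)
  with n5 D(1) obtain L ds where L: "distinct L" "?V = set L" "length L = 5" "D = edges_of L ds"
      and ds: "ds \<in> {[(0, 1), (1, 2), (0, 2)], [(0, 1), (1, 2), (1, 3)], [(0, 1), (1, 2), (2, 3)],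
        [(0, 1), (1, 2), (3, 4)]}"
    by (rule three_edges_cases)
  have "set ds \<subseteq> set (pairs 5)" using ds by (auto simp: set_pairs)
  hence E': "?E = edges_of L (pairs_without 5 ds)"
    using D(2) L by (intro edges_of_complement) simp_all
  obtain p where p: "p \<in> set (pairs 5)" "nbrs G w = {L ! fst p, L ! snd p}"
  proof -
    obtain x y where xy: "nbrs G w = {x, y}" "x \<noteq> y" using w(2) unfolding card_2_iff by blast
    hence "x \<in> ?V" "y \<in> ?V" using nbrs_subset[OF simple, of w] by auto
    hence "{x, y} \<in> all_edges (set L)" using xy(2) L(2) unfolding all_edges_def by blast
    then obtain i j where "(i, j) \<in> set (pairs 5)" "{x, y} = {L ! i, L ! j}"
      unfolding all_edges_eq_edges_of[OF L(1)] L(3) edges_of_def by auto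
    thus ?thesis using that[of "(i, j)"] xy(1) by simp
  qed
  let ?L = "L @ [w]" and ?ps = "pairs_without 5 ds @ [(fst p, 5), (snd p, 5)]"
  have L': "distinct ?L" "verts G = set ?L" "length ?L = 6" using L w(1) by auto
  have nth: "?L ! i = L ! i" if "i < 5" for i using that L(3) by (simp add: nth_append)
  have p5: "fst p < 5" "snd p < 5" using p(1) by (auto simp: set_pairs)
  have w5: "?L ! 5 = w" using L(3) by (metis nth_append_length)
  have E: "edges G = edges_of ?L ?ps"
  proof -
    have "edges_of ?L (pairs_without 5 ds) = edges_of L (pairs_without 5 ds)"
      unfolding edges_of_def
    proof (rule image_cong[OF refl])
      fix q assume "q \<in> set (pairs_without 5 ds)"
      hence "fst q < 5" "snd q < 5" by (auto simp: pairs_without_def set_pairs)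
      thus "(case q of (i, j) \<Rightarrow> {?L ! i, ?L ! j}) = (case q of (i, j) \<Rightarrow> {L ! i, L ! j})"
        by (simp add: split_beta nth)
    qed
    moreover have "{e \<in> edges G. w \<in> e} = edges_of ?L [(fst p, 5), (snd p, 5)]"
      unfolding incident_edges[OF simple] p(2) using p5 by (simp add: edges_of_def nth w5 insert_commute)
    moreover have "edges_of ?L ?ps = edges_of ?L (pairs_without 5 ds) \<union> edges_of ?L [(fst p, 5), (snd p, 5)]"
      unfolding edges_of_def by (simp only: set_append image_Un)
    ultimately show ?thesis using split E' by simp
  qed
  have no: False if "five_cycles 6 ?ps e xss" for e xss
    using not_4_cactus_if_five_cycles[OF k L'(1,3) _ that] E by simp
  consider (tri) "ds = [(0, 1), (1, 2), (0, 2)]" | (star) "ds = [(0, 1), (1, 2), (1, 3)]"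
    | (path) "ds = [(0, 1), (1, 2), (2, 3)]" | (p3k2) "ds = [(0, 1), (1, 2), (3, 4)]"
    using ds by blast
  thus ?thesis
  proof cases
    case tri
    show ?thesis
    proof (cases "p = (3, 4)")
      case True
      thus ?thesis using graph_iso_theta_12222[OF L'(1) L(3) L'(2)] E tri by simp
    next
      case False
      obtain e xss where "five_cycles 6 ?ps e xss"
        unfolding tri using p(1) False by (rule five_cycles_triangle)
      thus ?thesis using no by blast
    qed
  next
    case star
    show ?thesis
    proof (cases "p = (1, 4)")
      case True
      obtain a b c d g where abc: "L = [a, b, c, d, g]" using L(3) by (rule list_of_length_5E)
      have E6: "edges G = {{a, c}, {a, d}, {c, d}, {a, g}, {b, g}, {c, g}, {d, g}, {b, w}, {g, w}}"
        unfolding E star True pairs_without_star abc by (simp add: edges_of_def)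
      have V6: "verts G = {a, b, c, d, g, w}" using L'(2) abc by simp
      have dist: "distinct [a, b, c, d, g, w]" using L'(1) abc by simp
      \<comment> \<open>The exceptional attachment: \<open>b\<close>, \<open>g\<close>,
        \<open>w\<close> form a triangle that hangs at \<open>g\<close>.\<close>
      have "split_at G g {b, g, w} {a, c, d, g}"
        unfolding split_at_def E6 V6 using dist by auto
      moreover have "2 \<le> card {b, g, w}" "2 \<le> card {a, c, d, g}" using dist by simp_all
      ultimately show ?thesis using ns unfolding nonseparable_def by blast
    next
      case False
      obtain e xss where "five_cycles 6 ?ps e xss"
        unfolding star using p(1) False by (rule five_cycles_star)
      thus ?thesis using no by blast
    qed
  next
    case path
    obtain e xss where "five_cycles 6 ?ps e xss"
      unfolding path using p(1) by (rule five_cycles_path)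
    thus ?thesis using no by blast
  next
    case p3k2
    obtain e xss where "five_cycles 6 ?ps e xss"
      unfolding p3k2 using p(1) by (rule five_cycles_path_edge)
    thus ?thesis using no by blast
  qed
qed

text \<open>The cubic graphs on six vertices are K_{3,3} and the prism, and both have an edge on
  five cycles. They are recognised from a vertex \<open>v\<close> and its two non-neighbours
  \<open>d\<close> and \<open>g\<close>.\<close>

lemma block_6_vertices_cubic:
  assumes k: "k_cactus 4 G" and n: "card (verts G) = 6"
    and cubic: "\<And>v. v \<in> verts G \<Longrightarrow> card (nbrs G v) = 3"
  shows False
proof -
  have simple: "finite_simple_graph G" using k unfolding k_cactus_def by auto
  hence fin: "finite (verts G)" unfolding finite_simple_graph_def by auto
  note sub = nbrs_subset[OF simple]
  have finN: "finite (nbrs G v)" for v using sub fin by (meson finite_Diff finite_subset)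
  have "verts G \<noteq> {}" using n by auto
  then obtain v where v: "v \<in> verts G" by blast
  have "card (verts G - {v} - nbrs G v) = 2"
    using card_Diff_subset[OF finN sub, of v] n v cubic[OF v] by simp
  then obtain d g where dg: "verts G - {v} - nbrs G v = {d, g}" "d \<noteq> g" unfolding card_2_iff by blast
  have V: "verts G = {v, d, g} \<union> nbrs G v" using dg(1) sub[of v] v by blast
  have mem: "d \<in> verts G" "g \<in> verts G" "d \<noteq> v" "g \<noteq> v" "d \<notin> nbrs G v" "g \<notin> nbrs G v" using dg(1) by blast+
  hence vn: "v \<notin> nbrs G d" "v \<notin> nbrs G g" using nbrs_sym[of v G] by auto
  have edge: "{x, y} \<in> edges G" if "y \<in> nbrs G x" for x y using that by (simp add: nbrs_def)
  have NV: "nbrs G x \<subseteq> {v, d, g} \<union> nbrs G v - {x}" for x using sub[of x] V by simp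
  show False
  proof (cases "g \<in> nbrs G d")
    case False
    hence "d \<notin> nbrs G g" using nbrs_sym[of g G d] by simp
    hence "nbrs G g \<subseteq> nbrs G v" using vn(2) NV[of g] by blast
    moreover have "nbrs G d \<subseteq> nbrs G v" using False vn(1) NV[of d] by blast
    \<comment> \<open>With \<open>d\<close> and \<open>g\<close> nonadjacent, the graph is K_{3,3}
      with {v, d, g} as one side.\<close>
    ultimately have eq: "nbrs G d = nbrs G v" "nbrs G g = nbrs G v"
      using card_subset_eq[OF finN] cubic[OF v] cubic[OF mem(1)] cubic[OF mem(2)] by simp_all
    obtain a b c where abc: "nbrs G v = {a, b, c}" "a \<noteq> b" "a \<noteq> c" "b \<noteq> c"
      using cubic[OF v] unfolding card_3_iff by blast
    let ?L = "[v, a, b, c, d, g]"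
    let ?ps = "[(0, 1), (0, 2), (0, 3), (1, 4), (2, 4), (3, 4), (1, 5), (2, 5), (3, 5)]"
    have "distinct ?L" using abc mem dg(2) sub[of v] by auto
    moreover have "edges_of ?L ?ps \<subseteq> edges G"
      using edge[of _ v] edge[of _ d] edge[of _ g] unfolding eq abc(1)
      by (simp add: edges_of_def insert_commute)
    moreover have "five_cycles 6 ?ps (0, 1)
        [[0, 1, 4, 2], [0, 1, 4, 3], [0, 1, 5, 2], [0, 1, 5, 3], [0, 1, 4, 2, 5, 3]]"
      by code_simp
    moreover have "length ?L = 6" by simp
    ultimately show False by (intro not_4_cactus_if_five_cycles[OF k])
  next
    case True
    hence dG: "d \<in> nbrs G g" using nbrs_sym[of g G d] by simp
    have "card (nbrs G d - {g}) = 2" "card (nbrs G g - {d}) = 2"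
      using True dG cubic[OF mem(1)] cubic[OF mem(2)] by (simp_all add: card_Diff_singleton)
    then obtain a b where ab: "nbrs G d - {g} = {a, b}" "a \<noteq> b" unfolding card_2_iff by blast
    have abv: "{a, b} \<subseteq> nbrs G v" using ab(1) vn(1) NV[of d] by blast
    hence "card (nbrs G v - {a, b}) = 1" using cubic[OF v] ab(2) card_Diff_subset[of "{a, b}" "nbrs G v"] by simp
    then obtain c where c: "nbrs G v - {a, b} = {c}" by (auto simp: card_1_singleton_iff)
    have nv: "nbrs G v = {a, b, c}" using c abv by blast
    have nd: "nbrs G d = {g, a, b}" using ab(1) True by blast
    have "c \<notin> {a, b}" using c by blast
    hence dist: "distinct [v, a, b, c, d, g]" using ab(2) nv mem dg(2) sub[of v] by auto
    have gv: "nbrs G g - {d} \<subseteq> {a, b, c}" using vn(2) NV[of g] nv by blast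
    have cV: "c \<in> verts G" "a \<in> verts G" "b \<in> verts G" using nv V by auto
    have cd: "d \<notin> nbrs G c" using nd dist nbrs_sym[of d G c] by auto
    have fin3: "nbrs G x = {p, q, r}" if "nbrs G x \<subseteq> {p, q, r}" "x \<in> verts G" for x p q r
    proof (rule card_subset_eq[OF _ that(1)])
      show "card (nbrs G x) = card {p, q, r}"
        using card_mono[OF _ that(1)] cubic[OF that(2)] card_length[of "[p, q, r]"] by simp
    qed simp
    \<comment> \<open>If \<open>d\<close> and \<open>g\<close> have both further neighbours in
      common, then \<open>c\<close> can only be adjacent to \<open>v\<close>, \<open>a\<close> and
      \<open>b\<close>; the edge from \<open>c\<close> to \<open>a\<close> completes a
      certificate.\<close>
    have same: False if "nbrs G g = {d, a, b}"
    proof -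
      have "g \<notin> nbrs G c" using that dist nbrs_sym[of g G c] by auto
      hence "nbrs G c \<subseteq> {v, a, b}" using cd NV[of c] nv by blast
      hence "a \<in> nbrs G c" using fin3 cV(1) by blast
      let ?L = "[v, a, b, c, d, g]"
      let ?ps = "[(0, 1), (0, 2), (0, 3), (4, 5), (1, 4), (2, 4), (1, 5), (2, 5), (1, 3)]"
      let ?xss = "[[0, 1, 3], [0, 1, 4, 2], [0, 1, 5, 2], [0, 1, 4, 5, 2], [0, 1, 5, 4, 2]]"
      have "edges_of ?L ?ps \<subseteq> edges G"
        using edge[of _ v] edge[of _ d] edge[of _ g] edge[OF \<open>a \<in> nbrs G c\<close>] unfolding nv nd that
        by (simp add: edges_of_def insert_commute)
      moreover have "five_cycles 6 ?ps (0, 1) ?xss" by code_simp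
      moreover have "length ?L = 6" by simp
      ultimately show False by (intro not_4_cactus_if_five_cycles[OF k dist])
    qed
    \<comment> \<open>Here b' is the only common neighbour of \<open>d\<close> and \<open>g\<close>,
      and a' is the other further neighbour of \<open>d\<close>. This is the prism with triangles v,
      a', c and b', d, g.\<close>
    have prism: False
      if g: "nbrs G g = {d, b', c}" and a'b': "{a', b'} = {a, b}" "a' \<noteq> b'" for a' b'
    proof -
      have nd': "nbrs G d = {g, a', b'}" and nv': "nbrs G v = {a', b', c}"
        using nd nv a'b'(1) by auto
      have dist': "distinct [v, a', b', c, d, g]"
        using dist a'b' by (auto simp: doubleton_eq_iff)
      have V': "a' \<in> verts G" "b' \<in> verts G" using nv' V by auto
      have "v \<in> nbrs G b'" "d \<in> nbrs G b'" "g \<in> nbrs G b'"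
        using nv' nd' g nbrs_sym[of b' G] by auto
      hence "{v, d, g} \<subseteq> nbrs G b'" by simp
      hence nb: "nbrs G b' = {v, d, g}"
        using card_subset_eq[OF finN, of "{v, d, g}" b'] cubic[OF V'(2)] dist' by simp
      have "b' \<notin> nbrs G a'" using nb dist' nbrs_sym[of b' G a'] by auto
      moreover have "g \<notin> nbrs G a'" using g dist' nbrs_sym[of g G a'] by auto
      ultimately have "nbrs G a' \<subseteq> {v, d, c}" using NV[of a'] nv' by blast
      hence "c \<in> nbrs G a'" using fin3 V'(1) by blast
      let ?L = "[v, a', b', c, d, g]"
      let ?ps = "[(0, 1), (0, 2), (0, 3), (4, 5), (1, 4), (2, 4), (2, 5), (3, 5), (1, 3)]"
      let ?xss = "[[0, 1, 3], [0, 1, 4, 2], [0, 1, 3, 5, 2], [0, 1, 4, 5, 2], [0, 1, 4, 5, 3]]"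
      have "edges_of ?L ?ps \<subseteq> edges G"
        using edge[of _ v] edge[of _ d] edge[of _ g] edge[OF \<open>c \<in> nbrs G a'\<close>] unfolding nv' nd' g
        by (simp add: edges_of_def insert_commute)
      moreover have "five_cycles 6 ?ps (0, 1) ?xss" by code_simp
      moreover have "length ?L = 6" by simp
      ultimately show False by (intro not_4_cactus_if_five_cycles[OF k dist'])
    qed
    obtain x y where xy: "nbrs G g - {d} = {x, y}" "x \<noteq> y"
      using \<open>card (nbrs G g - {d}) = 2\<close> unfolding card_2_iff by blast
    hence "x \<in> {a, b, c}" "y \<in> {a, b, c}" "nbrs G g = {d, x, y}" using gv dG by blast+
    hence "nbrs G g = {d, a, b} \<or> nbrs G g = {d, a, c} \<or> nbrs G g = {d, b, c}"
      using xy(2) by auto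
    thus False using same prism[of a b] prism[of b a] ab(2) by (auto simp: insert_commute)
  qed
qed

text \<open>The degrees are at least 2 and have sum 18 on six vertices, so without a vertex of
  degree 2 they are all equal to 3.\<close>

lemma block_6_vertices_9_edges:
  assumes k: "k_cactus 4 G" and ns: "nonseparable G"
    and n: "card (verts G) = 6" and e: "card (edges G) = 9"
  shows "graph_iso (theta [1, 2, 2, 2, 2]) G"
proof -
  have simple: "finite_simple_graph G" and con: "connected_graph G" using k unfolding k_cactus_def by auto
  hence fin: "finite (verts G)" unfolding finite_simple_graph_def by auto
  have ge2: "2 \<le> card (nbrs G v)" if "v \<in> verts G" for v
    using nonseparable_card_nbrs_ge[OF simple con ns _ that] n by simp
  have "\<exists>w \<in> verts G. card (nbrs G w) = 2"
  proof (rule ccontr)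
    assume no: "\<not> ?thesis"
    have ge3: "3 \<le> card (nbrs G v)" if "v \<in> verts G" for v
    proof -
      have "card (nbrs G v) \<noteq> 2" using no that by blast
      thus ?thesis using ge2[OF that] by linarith
    qed
    have "card (nbrs G v) = 3" if "v \<in> verts G" for v
    proof (rule ccontr)
      assume "card (nbrs G v) \<noteq> 3"
      hence "3 < card (nbrs G v)" using ge3[OF that] by simp
      hence "(\<Sum>v \<in> verts G. 3) < (\<Sum>v \<in> verts G. card (nbrs G v))"
        using ge3 that fin by (intro sum_strict_mono_ex1) auto
      thus False using sum_card_nbrs[OF simple] n e by simp
    qed
    thus False by (rule block_6_vertices_cubic[OF k n])
  qed
  thus ?thesis using block_6_vertices_degree_2[OF k ns n e] by blast
qed

section \<open>Structure of 4-cacti\<close>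

text \<open>The order \<open>m\<close> is kept beside the graph because its residue modulo 3, which
  is 0 or 2, later selects the case of the theorem. Blocks with four vertices and five edges are
  left out; they lead to the residue 1.\<close>

definition defect_one_block :: "nat ugraph \<Rightarrow> nat \<Rightarrow> bool" where
  "defect_one_block T m \<longleftrightarrow> (m = 2 \<and> T = complete_graph 2) \<or> (m = 3 \<and> T = complete_graph 3) \<or>
     (m = 5 \<and> T \<in> {theta [1, 2, 2, 2], theta_tilde1, theta_tilde2}) \<or>
     (m = 6 \<and> T = theta [1, 2, 2, 2, 2])"

lemma edges_of_subset_all_edges:
  assumes "distinct L" "set ps \<subseteq> set (pairs (length L))"
  shows "edges_of L ps \<subseteq> all_edges (set L)"
  unfolding all_edges_eq_edges_of[OF assms(1)] unfolding edges_of_def using assms(2) by (rule image_mono)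

lemma finite_simple_complete: "finite_simple_graph (complete_graph m)"
  by (simp add: finite_simple_graph_def complete_graph_def)

lemma finite_simple_defect_one_block:
  assumes "defect_one_block T m"
  shows "finite_simple_graph T"
proof -
  have *: "finite_simple_graph ({0..<m}, edges_of [0..<m] ps)" if "set ps \<subseteq> set (pairs m)" for m ps
    using edges_of_subset_all_edges[of "[0..<m]" ps] that by (simp add: finite_simple_graph_def)
  have "finite_simple_graph (theta [1, 2, 2, 2])" "finite_simple_graph (theta [1, 2, 2, 2, 2])"
    "finite_simple_graph theta_tilde1" "finite_simple_graph theta_tilde2"
    unfolding theta_1222 theta_12222 theta_tilde_edges_of
    by (rule *, force simp: set_pairs pairs_without_def)+
  thus ?thesis using assms finite_simple_complete unfolding defect_one_block_def by blast
qed

lemma block_card_edges_le: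
  assumes k: "k_cactus 4 G" and ns: "nonseparable G"
  shows "card (edges G) \<le> card (verts G) + 3"
proof (cases "edges G = {}")
  case False
  have simple: "finite_simple_graph G" and con: "connected_graph G" using k unfolding k_cactus_def by auto
  obtain e where e: "e \<in> edges G" using False by blast
  then obtain u v where "e = {u, v}" using simple by (metis simple_edgeE)
  with e have uv: "{u, v} \<in> edges G" by simp
  have "card {C. is_cycle G C \<and> {u, v} \<in> C} \<le> 4" using k uv unfolding k_cactus_def by blast
  thus ?thesis using card_cycles_through_edge_ge[OF simple con ns uv] by linarith
qed simp

text \<open>For orders 2, 3 and 4 the complete graph has 1, 3 and 6 edges against 2, 4 and 6. For
  orders 5 and 6 the ear bound allows 8 and 9 against 8 and 10, and 8 is excluded. From order 7 on,
  n + 3 is at least two below 2(n - 1).\<close>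

lemma block_cases:
  assumes k: "k_cactus 4 G" and ns: "nonseparable G" and n: "2 \<le> card (verts G)"
  shows "card (edges G) \<le> 2 * (card (verts G) - 1)"
    and "card (edges G) = 2 * (card (verts G) - 1) \<Longrightarrow>
      card (verts G) = 4 \<and> graph_iso (complete_graph 4) G"
    and "card (edges G) + 1 = 2 * (card (verts G) - 1) \<Longrightarrow>
      card (verts G) = 4 \<or> (\<exists>T. defect_one_block T (card (verts G)) \<and> graph_iso T G)"
proof -
  have simple: "finite_simple_graph G" using k unfolding k_cactus_def by auto
  hence fin: "finite (verts G)" and sub: "edges G \<subseteq> all_edges (verts G)"
    unfolding finite_simple_graph_def by auto
  have le: "card (edges G) \<le> card (verts G) + 3" by (rule block_card_edges_le[OF k ns])
  have ch: "card (edges G) \<le> card (verts G) choose 2"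
    using card_mono[OF finite_all_edges[OF fin] sub] card_all_edges[OF fin] by simp
  have full: "graph_iso (complete_graph (card (verts G))) G"
    if "card (edges G) = card (verts G) choose 2"
  proof -
    have "edges G = all_edges (verts G)"
      using card_subset_eq[OF finite_all_edges[OF fin] sub] that card_all_edges[OF fin] by simp
    thus ?thesis using fin by (intro graph_iso_complete) simp_all
  qed
  consider "card (verts G) = 2" | "card (verts G) = 3" | "card (verts G) = 4" | "card (verts G) = 5"
    | "card (verts G) = 6" | "7 \<le> card (verts G)"
    using n by linarith
  hence "card (edges G) \<le> 2 * (card (verts G) - 1) \<and>
    (card (edges G) = 2 * (card (verts G) - 1) \<longrightarrow>
      card (verts G) = 4 \<and> graph_iso (complete_graph 4) G) \<and>
    (card (edges G) + 1 = 2 * (card (verts G) - 1) \<longrightarrow>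
      card (verts G) = 4 \<or> (\<exists>T. defect_one_block T (card (verts G)) \<and> graph_iso T G))"
  proof cases
    case 1
    hence "card (edges G) \<le> 1" using ch by (simp add: choose_two)
    thus ?thesis using full 1 by (auto simp: choose_two defect_one_block_def)
  next
    case 2
    hence "card (edges G) \<le> 3" using ch by (simp add: choose_two)
    thus ?thesis using full 2 by (auto simp: choose_two defect_one_block_def)
  next
    case 3
    hence "card (edges G) \<le> 6" using ch by (simp add: choose_two)
    thus ?thesis using full 3 by (auto simp: choose_two)
  next
    case 4
    have "card (edges G) \<noteq> 8" using block_5_vertices_8_edges[OF k 4] by blast
    moreover have "\<exists>T. defect_one_block T 5 \<and> graph_iso T G" if "card (edges G) = 7"
      using block_5_vertices_7_edges[OF k ns 4 that] unfolding defect_one_block_def by blast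
    moreover have "card (edges G) \<le> 8" using le 4 by simp
    ultimately show ?thesis using 4 by (auto simp del: split_paired_Ex)
  next
    case 5
    have "\<exists>T. defect_one_block T 6 \<and> graph_iso T G" if "card (edges G) = 9"
      using block_6_vertices_9_edges[OF k ns 5 that] unfolding defect_one_block_def by blast
    moreover have "card (edges G) \<le> 9" using le 5 by simp
    ultimately show ?thesis using 5 by (auto simp del: split_paired_Ex)
  next
    case 6
    thus ?thesis using le by auto
  qed
  thus "card (edges G) \<le> 2 * (card (verts G) - 1)"
    and "card (edges G) = 2 * (card (verts G) - 1) \<Longrightarrow>
      card (verts G) = 4 \<and> graph_iso (complete_graph 4) G"
    and "card (edges G) + 1 = 2 * (card (verts G) - 1) \<Longrightarrow>
      card (verts G) = 4 \<or> (\<exists>T. defect_one_block T (card (verts G)) \<and> graph_iso T G)"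
    by blast+
qed

lemma replicate_mset_plus: "replicate_mset (r + s) x = replicate_mset r x + replicate_mset s x"
  by (induction r) simp_all

text \<open>Induction over cut vertices, with additive defects. One vertex stands apart in defect 0,
  since no graph is a coalescence of the empty multiset. In defect 1 the residue alternative absorbs
  the four-vertex blocks with five edges.\<close>

lemma cactus_structure:
  assumes "k_cactus 4 G" "1 \<le> card (verts G)"
  shows "card (edges G) \<le> 2 * (card (verts G) - 1) \<and>
    (card (edges G) = 2 * (card (verts G) - 1) \<longrightarrow> card (verts G) = 1 \<or>
      (\<exists>r. card (verts G) = 3 * r + 1 \<and>
        obtained_by_coalescing (replicate_mset r (complete_graph 4)) G)) \<and>
    (card (edges G) + 1 = 2 * (card (verts G) - 1) \<longrightarrow> card (verts G) mod 3 = 1 \<or>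
      (\<exists>r T m. card (verts G) = 3 * r + m \<and> defect_one_block T m \<and>
        obtained_by_coalescing (replicate_mset r (complete_graph 4) + {#T#}) G))"
  using assms
proof (induction "card (verts G)" arbitrary: G rule: less_induct)
  case less
  note k = less.prems(1)
  have simple: "finite_simple_graph G" using k unfolding k_cactus_def by auto
  show ?case
  proof (cases "nonseparable G")
    case ns: True
    show ?thesis
    proof (cases "card (verts G) = 1")
      case True
      then obtain x where "verts G = {x}" by (auto simp: card_1_singleton_iff)
      hence "edges G = {}" using simple unfolding finite_simple_graph_def all_edges_def by auto
      thus ?thesis using True by simp
    next
      case False
      hence n: "2 \<le> card (verts G)" using less.prems(2) by linarith
      note b = block_cases[OF k ns n]
      show ?thesis
      proof (intro conjI impI)
        assume "card (edges G) = 2 * (card (verts G) - 1)"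
        hence "card (verts G) = 4" "graph_iso (complete_graph 4) G" using b(2) by auto
        thus "card (verts G) = 1 \<or> (\<exists>r. card (verts G) = 3 * r + 1 \<and>
            obtained_by_coalescing (replicate_mset r (complete_graph 4)) G)"
          using obtained_by_coalescing_single[OF finite_simple_complete]
          by (intro disjI2 exI[of _ 1]) simp
      next
        assume "card (edges G) + 1 = 2 * (card (verts G) - 1)"
        then consider "card (verts G) = 4"
          | T where "defect_one_block T (card (verts G))" "graph_iso T G"
          using b(3) by blast
        thus "card (verts G) mod 3 = 1 \<or>
          (\<exists>r T m. card (verts G) = 3 * r + m \<and> defect_one_block T m \<and>
            obtained_by_coalescing (replicate_mset r (complete_graph 4) + {#T#}) G)"
        proof cases
          case 2
          have "obtained_by_coalescing {#T#} G"
            by (rule obtained_by_coalescing_single[OF finite_simple_defect_one_block[OF 2(1)] 2(2)])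
          thus ?thesis using 2(1)
            by (intro disjI2 exI[of _ 0] exI[of _ T] exI[of _ "card (verts G)"]) simp
        qed simp
      qed (rule b(1))
    qed
  next
    case False
    then obtain v A B where split: "split_at G v A B" and AB: "2 \<le> card A" "2 \<le> card B"
      unfolding nonseparable_def by blast
    note c = card_edges_split[OF simple split]
    let ?A = "induced G A" and ?B = "induced G B"
    have vA: "verts ?A = A" "verts ?B = B" by (simp_all add: induced_def)
    have kA: "k_cactus 4 ?A" and kB: "k_cactus 4 ?B"
      using k_cactus_induced_split[OF k] split split_at_sym[OF split] by blast+
    have lt: "card (verts ?A) < card (verts G)" "card (verts ?B) < card (verts G)"
      using c(2) AB unfolding vA by linarith+
    \<comment> \<open>Both parts have at least two vertices, which removes the one-vertex
      alternative from the induction hypothesis.\<close>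
    have A: "card (edges ?A) \<le> 2 * (card A - 1)"
      "card (edges ?A) = 2 * (card A - 1) \<Longrightarrow> (\<exists>r. card A = 3 * r + 1 \<and>
        obtained_by_coalescing (replicate_mset r (complete_graph 4)) ?A)"
      "card (edges ?A) + 1 = 2 * (card A - 1) \<Longrightarrow> card A mod 3 = 1 \<or>
        (\<exists>r T m. card A = 3 * r + m \<and> defect_one_block T m \<and>
        obtained_by_coalescing (replicate_mset r (complete_graph 4) + {#T#}) ?A)"
      using less.hyps[OF lt(1) kA] AB(1) unfolding vA by auto
    have B: "card (edges ?B) \<le> 2 * (card B - 1)"
      "card (edges ?B) = 2 * (card B - 1) \<Longrightarrow> (\<exists>r. card B = 3 * r + 1 \<and>
        obtained_by_coalescing (replicate_mset r (complete_graph 4)) ?B)"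
      "card (edges ?B) + 1 = 2 * (card B - 1) \<Longrightarrow> card B mod 3 = 1 \<or>
        (\<exists>r T m. card B = 3 * r + m \<and> defect_one_block T m \<and>
        obtained_by_coalescing (replicate_mset r (complete_graph 4) + {#T#}) ?B)"
      using less.hyps[OF lt(2) kB] AB(2) unfolding vA by auto
    note join = obtained_by_coalescing_split[OF split]
    let ?K = "complete_graph 4"
    show ?thesis
    proof (intro conjI impI)
      show "card (edges G) \<le> 2 * (card (verts G) - 1)" using A(1) B(1) c AB by linarith
    next
      assume "card (edges G) = 2 * (card (verts G) - 1)"
      hence "card (edges ?A) = 2 * (card A - 1)" "card (edges ?B) = 2 * (card B - 1)"
        using A(1) B(1) c AB by linarith+
      then obtain r s where "card A = 3 * r + 1" "card B = 3 * s + 1"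
        and o: "obtained_by_coalescing (replicate_mset r ?K) ?A" "obtained_by_coalescing (replicate_mset s ?K) ?B"
        using A(2) B(2) by blast
      moreover have "obtained_by_coalescing (replicate_mset (r + s) ?K) G"
        using join[OF o] by (simp add: replicate_mset_plus)
      ultimately show "card (verts G) = 1 \<or> (\<exists>r. card (verts G) = 3 * r + 1 \<and>
            obtained_by_coalescing (replicate_mset r ?K) G)"
        using c(2) by (intro disjI2 exI[of _ "r + s"]) simp
    next
      assume "card (edges G) + 1 = 2 * (card (verts G) - 1)"
      \<comment> \<open>Two defects, both at least 0, with sum 1: one part has defect 0 and the
        other has defect 1.\<close>
      hence "card (edges ?A) = 2 * (card A - 1) \<and> card (edges ?B) + 1 = 2 * (card B - 1) \<or>
          card (edges ?B) = 2 * (card B - 1) \<and> card (edges ?A) + 1 = 2 * (card A - 1)"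
        using A(1) B(1) c AB by linarith
      thus "card (verts G) mod 3 = 1 \<or>
          (\<exists>r T m. card (verts G) = 3 * r + m \<and> defect_one_block T m \<and>
            obtained_by_coalescing (replicate_mset r ?K + {#T#}) G)"
      proof (elim disjE conjE)
        assume "card (edges ?A) = 2 * (card A - 1)" and e: "card (edges ?B) + 1 = 2 * (card B - 1)"
        then obtain r where r: "card A = 3 * r + 1" "obtained_by_coalescing (replicate_mset r ?K) ?A"
          using A(2) by blast
        from B(3)[OF e] show ?thesis
        proof (elim disjE exE conjE)
          \<comment> \<open>The other part has 3r + 1 vertices and shares the cut vertex, so the
            residue is unchanged.\<close>
          assume "card B mod 3 = 1"
          hence "card (verts G) mod 3 = 1" using r(1) c(2) by presburger
          thus ?thesis ..
        next
          fix s T m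
          assume s: "card B = 3 * s + m" "defect_one_block T m"
            "obtained_by_coalescing (replicate_mset s ?K + {#T#}) ?B"
          have "obtained_by_coalescing (replicate_mset (r + s) ?K + {#T#}) G"
            using join[OF r(2) s(3)] by (simp add: replicate_mset_plus)
          moreover have "card (verts G) = 3 * (r + s) + m" using c(2) r(1) s(1) by simp
          ultimately show ?thesis using s(2) by blast
        qed
      next
        assume "card (edges ?B) = 2 * (card B - 1)" and e: "card (edges ?A) + 1 = 2 * (card A - 1)"
        then obtain r where r: "card B = 3 * r + 1" "obtained_by_coalescing (replicate_mset r ?K) ?B"
          using B(2) by blast
        from A(3)[OF e] show ?thesis
        proof (elim disjE exE conjE)
          assume "card A mod 3 = 1"
          hence "card (verts G) mod 3 = 1" using r(1) c(2) by presburger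
          thus ?thesis ..
        next
          fix s T m
          assume s: "card A = 3 * s + m" "defect_one_block T m"
            "obtained_by_coalescing (replicate_mset s ?K + {#T#}) ?A"
          have "obtained_by_coalescing (replicate_mset (s + r) ?K + {#T#}) G"
            using join[OF s(3) r(2)] by (simp add: replicate_mset_plus)
          moreover have "card (verts G) = 3 * (s + r) + m" using c(2) r(1) s(1) by simp
          ultimately show ?thesis using s(2) by blast
        qed
      qed
    qed
  qed
qed

theorem theorem7:
  fixes G :: "'a ugraph" and n :: nat
  assumes "n \<ge> 1"
    and "extremal_k_cactus 4 n G"
  shows "(n mod 3 = 0 \<longrightarrow>
            obtained_by_coalescing
              (replicate_mset ((n - 3) div 3) (complete_graph 4) + {#complete_graph 3#}) G
          \<or> (n \<ge> 6 \<and> obtained_by_coalescing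
              (replicate_mset ((n - 6) div 3) (complete_graph 4) + {#theta [1, 2, 2, 2, 2]#}) G))
       \<and> (n mod 3 = 1 \<and> n \<noteq> 1 \<longrightarrow>
            obtained_by_coalescing (replicate_mset ((n - 1) div 3) (complete_graph 4)) G)
       \<and> (n = 1 \<longrightarrow> graph_iso G (complete_graph 1))
       \<and> (n mod 3 = 2 \<longrightarrow>
            obtained_by_coalescing
              (replicate_mset ((n - 2) div 3) (complete_graph 4) + {#complete_graph 2#}) G
          \<or> (n \<ge> 5 \<and> (\<exists>T \<in> {theta [1, 2, 2, 2], theta_tilde1, theta_tilde2}.
              obtained_by_coalescing
                (replicate_mset ((n - 5) div 3) (complete_graph 4) + {#T#}) G)))"
proof -
  have k: "k_cactus 4 G" and n: "card (verts G) = n"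
    and max: "\<And>H :: 'a ugraph. k_cactus 4 H \<Longrightarrow> card (verts H) = n \<Longrightarrow> card (edges H) \<le> card (edges G)"
    using assms(2) unfolding extremal_k_cactus_def by auto
  have simple: "finite_simple_graph G" using k unfolding k_cactus_def by auto
  hence fin: "finite (verts G)" unfolding finite_simple_graph_def by simp
  have "verts G \<noteq> {}" using n assms(1) by auto
  \<comment> \<open>A competitor on the same vertices bounds the defect of \<open>G\<close> from
    above.\<close>
  with fin obtain H where H: "verts H = verts G" "k_cactus 4 H"
      "2 * (card (verts G) - 1) \<le> card (edges H) + (if card (verts G) mod 3 = 1 then 0 else 1)"
    using large_4_cactus_exists by metis
  have "card (edges H) \<le> card (edges G)" using max[OF H(2)] H(1) n by simp
  hence low: "2 * (n - 1) \<le> card (edges G) + (if n mod 3 = 1 then 0 else 1)" using H(3) n by (simp split: if_splits)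
  have "1 \<le> card (verts G)" using n assms(1) by simp
  note str = cactus_structure[OF k this, unfolded n]
  let ?K = "complete_graph 4"
  have one: "graph_iso G (complete_graph 1)" if "n = 1"
  proof -
    have "card (verts G) = 1" using n \<open>n = 1\<close> by simp
    then obtain x where x: "verts G = {x}" by (rule card_1_singletonE)
    hence "edges G = all_edges (verts G)" using simple unfolding finite_simple_graph_def all_edges_def by auto
    hence "graph_iso (complete_graph 1) G" using fin n that by (intro graph_iso_complete) simp_all
    thus ?thesis using finite_simple_complete by (rule graph_iso_sym)
  qed
  have mod1: "obtained_by_coalescing (replicate_mset ((n - 1) div 3) ?K) G" if n1: "n mod 3 = 1" "n \<noteq> 1"
  proof -
    have "card (edges G) = 2 * (n - 1)" using low str n1(1) by simp
    then obtain r where "n = 3 * r + 1" "obtained_by_coalescing (replicate_mset r ?K) G"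
      using str n1(2) by blast
    thus ?thesis by simp
  qed
  have other: "\<exists>r T m. n = 3 * r + m \<and> defect_one_block T m \<and>
      obtained_by_coalescing (replicate_mset r ?K + {#T#}) G" if "n mod 3 \<noteq> 1"
  proof -
    \<comment> \<open>Defect 0 would put \<open>n\<close> in the class of 1 modulo 3, so outside
      this class the defect is exactly 1.\<close>
    have "card (edges G) \<noteq> 2 * (n - 1)"
    proof
      assume "card (edges G) = 2 * (n - 1)"
      hence "n = 1 \<or> (\<exists>r. n = 3 * r + 1)" using str by blast
      thus False using that by auto
    qed
    moreover have "card (edges G) \<le> 2 * (n - 1)" using str by blast
    ultimately have "card (edges G) + 1 = 2 * (n - 1)" using low that by simp
    thus ?thesis using str that by blast
  qed
  have mod0: "obtained_by_coalescing (replicate_mset ((n - 3) div 3) ?K + {#complete_graph 3#}) G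
      \<or> (n \<ge> 6 \<and> obtained_by_coalescing
          (replicate_mset ((n - 6) div 3) ?K + {#theta [1, 2, 2, 2, 2]#}) G)" if "n mod 3 = 0"
  proof -
    from that other obtain r T m where rm: "n = 3 * r + m" "defect_one_block T m"
      "obtained_by_coalescing (replicate_mset r ?K + {#T#}) G" by auto
    have "m mod 3 = 0" using that rm(1) by simp
    \<comment> \<open>Copies of K_4 do not affect the residue, so \<open>m\<close> has the residue
      of \<open>n\<close>, which leaves two of the exceptional blocks.\<close>
    then consider "m = 3" "T = complete_graph 3" | "m = 6" "T = theta [1, 2, 2, 2, 2]"
      using rm(2) unfolding defect_one_block_def by force
    thus ?thesis using rm by cases simp_all
  qed
  have mod2: "obtained_by_coalescing (replicate_mset ((n - 2) div 3) ?K + {#complete_graph 2#}) G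
      \<or> (n \<ge> 5 \<and> (\<exists>T \<in> {theta [1, 2, 2, 2], theta_tilde1, theta_tilde2}.
          obtained_by_coalescing (replicate_mset ((n - 5) div 3) ?K + {#T#}) G))" if "n mod 3 = 2"
  proof -
    from that other obtain r T m where rm: "n = 3 * r + m" "defect_one_block T m"
      "obtained_by_coalescing (replicate_mset r ?K + {#T#}) G" by auto
    have "m mod 3 = 2" using that rm(1) by simp
    then consider "m = 2" "T = complete_graph 2"
      | "m = 5" "T \<in> {theta [1, 2, 2, 2], theta_tilde1, theta_tilde2}"
      using rm(2) unfolding defect_one_block_def by force
    thus ?thesis
    proof cases
      case 2
      have "n \<ge> 5" "(n - 5) div 3 = r" using rm(1) 2(1) by simp_all
      thus ?thesis using rm(3) 2(2) by blast
    qed (use rm in simp)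
  qed
  show ?thesis using one mod1 mod0 mod2 by blast
qed

end
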